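(* Let $\mathcal{F}$ be a family of pairs $(f,g)$ of non-negative measurable functions on $\mathbb{R}^n$. Suppose that for some $p_0$, $1<p_0<\infty$, and every $w_0\in A_{p_0}$, $$\int_{\mathbb{R}^n} f(x)^{p_0}w_0(x)\,dx\le C\int_{\mathbb{R}^n} g(x)^{p_0}w_0(x)\,dx,\qquad (f,g)\in\mathcal{F}.$$ Then for any $M$-pair $(p(\cdot),w)$, $$\|f\|_{L^{p(\cdot)}(w)}\le C\|g\|_{L^{p(\cdot)}(w)},\qquad (f,g)\in\mathcal{F}.$$ The theorem holds if $p_0=1$ (i.e. if the hypothesis holds with $p_0=1$ and every $w_0\in A_1$) if we assume only that the maximal operator $M$ is bounded on $L^{p'(\cdot)}(w^{-1})$.
   Context: $\mathcal{P}$ is the set of measurable $p(\cdot):\mathbb{R}^n\to[1,\infty]$. The conjugate exponent $p'(\cdot)$ is defined pointwise by $1/p(x)+1/p'(x)=1$ with $1/\infty=0$. With $\mathbb{R}^n_\infty=\{x:p(x)=\infty\}$, $$\|f\|_{p(\cdot)}=\inf\Big\{\lambda>0:\int_{\mathbb{R}^n\setminus\mathbb{R}^n_\infty}\Big(\frac{|f(x)|}{\lambda}\Big)^{p(x)}dx+\lambda^{-1}\|f\|_{L^\infty(\mathbb{R}^n_\infty)}\le1\Big\}.$$ A weight is a non-negative measurable function; the weight $w$ used with a variable exponent $p(\cdot)\in\mathcal{P}$ satisfies $0<w(x)<\infty$ a.e. $L^{p(\cdot)}(w)$ is the set of measurable $f$ with $\|f\|_{L^{p(\cdot)}(w)}:=\|fw\|_{p(\cdot)}<\infty$.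 The Hardy-Littlewood maximal operator is $Mf(x)=\sup_{B\ni x}\frac1{|B|}\int_B|f(y)|\,dy$, supremum over balls $B\subset\mathbb{R}^n$ containing $x$. $M$ is bounded on $L^{p(\cdot)}(w)$ if $\|(Mf)w\|_{p(\cdot)}\le C\|fw\|_{p(\cdot)}$ for all $f\in L^{p(\cdot)}(w)$. $(p(\cdot),w)$, with $p(\cdot)\in\mathcal{P}$ and $w$ a weight, is an $M$-pair if $M$ is bounded on both $L^{p(\cdot)}(w)$ and $L^{p'(\cdot)}(w^{-1})$. Classical Muckenhoupt classes: for $1<p<\infty$, $w_0\in A_p$ iff $\sup_B\big(\frac1{|B|}\int_Bw_0\big)\big(\frac1{|B|}\int_Bw_0^{1-p'}\big)^{p-1}<\infty$; $w_0\in A_1$ iff $\sup_B\frac{|B|^{-1}\int_Bw_0}{\operatorname{ess\,inf}_Bw_0}<\infty$. Suprema are over balls $B\subset\mathbb{R}^n$. Convention: an inequality over $(f,g)\in\mathcal{F}$ (norm or weighted integral) means that it holds, with $C$ independent of the pair, for every pair $(f,g)\in\mathcal{F}$ for which the left-hand side is finite. *)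

theory Defs
  imports "HOL-Analysis.Analysis" "HOL-Probability.Essential_Supremum"
begin

text \<open>
  \<open>'a :: euclidean_space\<close> plays the role of \<open>\<real>\<^sup>n\<close>, and ``measurable'' means Lebesgue measurable.
  Non-negative functions and weights take values in \<open>[0,\<infinity>]\<close>, i.e. in \<^typ>\<open>ennreal\<close>, where
  \<open>0 * \<infinity> = 0\<close>.
\<close>

subsection \<open>Real powers of extended non-negative numbers\<close>

text \<open>The usual conventions \<open>0\<^sup>a = \<infinity>\<close>, \<open>\<infinity>\<^sup>a = 0\<close> are used for \<open>a < 0\<close>, and \<open>t\<^sup>0 = 1\<close>.\<close>

definition enn_powr :: "ennreal \<Rightarrow> real \<Rightarrow> ennreal" where
  "enn_powr t a =
     (if a = 0 then 1
      else if t = 0 then (if 0 < a then 0 else \<infinity>)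
      else if t = \<infinity> then (if 0 < a then \<infinity> else 0)
      else ennreal (enn2real t powr a))"


subsection \<open>Variable exponents and weighted variable Lebesgue norms\<close>

definition var_exponents :: "('a::euclidean_space \<Rightarrow> ennreal) set" where
  "var_exponents = {p \<in> borel_measurable lebesgue. \<forall>x. 1 \<le> p x}"

text \<open>The solution of \<open>1/p(x) + 1/p'(x) = 1\<close>; see \<open>conj_exponent_unique\<close> below.\<close>

definition conj_exponent :: "('a \<Rightarrow> ennreal) \<Rightarrow> 'a \<Rightarrow> ennreal" where
  "conj_exponent p x = 1 / (1 - 1 / p x)"

lemma inverse_inverse_ennreal: "inverse (inverse (t::ennreal)) = t"
  by (cases t)
    (auto, smt (verit, del_insts) ennreal_0 ennreal_inverse_eq_0_iff ennreal_inverse_zero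
      inverse_ennreal inverse_inverse_eq inverse_nonpositive_iff_nonpositive)

lemma conj_exponent_unique:
  assumes "1 \<le> p x"
  shows "1 / p x + 1 / q = 1 \<longleftrightarrow> q = conj_exponent p x"
proof -
  have le: "inverse (p x) \<le> 1"
    using assms by (metis divide_ennreal_def divide_le_posI_ennreal dual_order.strict_trans1
        ennreal_zero_less_one mult_1 mult_1_right)
  have "inverse (p x) + inverse q = 1 \<longleftrightarrow> inverse q = 1 - inverse (p x)"
    by (metis add_diff_eq_iff_ennreal add_top_left_ennreal le ennreal_add_diff_cancel_left
        ennreal_one_neq_top)
  also have "\<dots> \<longleftrightarrow> q = inverse (1 - inverse (p x))"
    by (metis inverse_inverse_ennreal)
  finally show ?thesis
    by (simp add: conj_exponent_def divide_ennreal_def)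
qed

text \<open>
  The modular and the norm depend only on \<open>\<bar>f\<bar>\<close>, so they are defined for \<open>[0,\<infinity>]\<close>-valued functions;
  for a real-valued \<open>f\<close> they are applied to \<open>\<bar>f\<bar>\<close>. The infimum over the empty set is \<open>\<infinity>\<close>.
\<close>

definition var_norm :: "('a::euclidean_space \<Rightarrow> ennreal) \<Rightarrow> ('a \<Rightarrow> ennreal) \<Rightarrow> ennreal" where
  "var_norm p f =
     (INF l \<in> {l::real. 0 < l \<and>
        (\<integral>\<^sup>+x\<in>{x. p x \<noteq> \<infinity>}. enn_powr (f x / ennreal l) (enn2real (p x)) \<partial>lebesgue)
        + esssup (restrict_space lebesgue {x. p x = \<infinity>}) f / ennreal l \<le> 1}. ennreal l)"

definition weights :: "('a::euclidean_space \<Rightarrow> ennreal) set" where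
  "weights = borel_measurable lebesgue"

definition pos_finite_weights :: "('a::euclidean_space \<Rightarrow> ennreal) set" where
  "pos_finite_weights = {w \<in> weights. AE x in lebesgue. 0 < w x \<and> w x < \<infinity>}"

definition weighted_norm ::
    "('a::euclidean_space \<Rightarrow> ennreal) \<Rightarrow> ('a \<Rightarrow> ennreal) \<Rightarrow> ('a \<Rightarrow> ennreal) \<Rightarrow> ennreal" where
  "weighted_norm p w f = var_norm p (\<lambda>x. f x * w x)"

definition weighted_Lp ::
    "('a::euclidean_space \<Rightarrow> ennreal) \<Rightarrow> ('a \<Rightarrow> ennreal) \<Rightarrow> ('a \<Rightarrow> real) set" where
  "weighted_Lp p w =
     {f \<in> borel_measurable lebesgue. weighted_norm p w (\<lambda>x. ennreal \<bar>f x\<bar>) < \<infinity>}"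


subsection \<open>The Hardy--Littlewood maximal operator\<close>

definition balls :: "'a::euclidean_space set set" where
  "balls = {ball c r |c r. 0 < r}"

definition avg :: "'a::euclidean_space set \<Rightarrow> ('a \<Rightarrow> ennreal) \<Rightarrow> ennreal" where
  "avg B h = (\<integral>\<^sup>+x\<in>B. h x \<partial>lebesgue) / emeasure lebesgue B"

definition maximal :: "('a::euclidean_space \<Rightarrow> real) \<Rightarrow> 'a \<Rightarrow> ennreal" where
  "maximal f x = (SUP B \<in> {B \<in> balls. x \<in> B}. avg B (\<lambda>y. ennreal \<bar>f y\<bar>))"

definition maximal_bounded :: "('a::euclidean_space \<Rightarrow> ennreal) \<Rightarrow> ('a \<Rightarrow> ennreal) \<Rightarrow> bool" where
  "maximal_bounded p w \<longleftrightarrow>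
     (\<exists>C::real. 0 < C \<and> (\<forall>f \<in> weighted_Lp p w.
        weighted_norm p w (maximal f) \<le> ennreal C * weighted_norm p w (\<lambda>x. ennreal \<bar>f x\<bar>)))"

definition M_pair :: "('a::euclidean_space \<Rightarrow> ennreal) \<Rightarrow> ('a \<Rightarrow> ennreal) \<Rightarrow> bool" where
  "M_pair p w \<longleftrightarrow>
     p \<in> var_exponents \<and> w \<in> pos_finite_weights \<and>
     maximal_bounded p w \<and> maximal_bounded (conj_exponent p) (\<lambda>x. inverse (w x))"


subsection \<open>Classical Muckenhoupt classes\<close>

text \<open>
  With the arithmetic of \<^typ>\<open>ennreal\<close> (in particular \<open>0 / 0 = \<infinity> / \<infinity> = 0\<close>) the weights that
  are a.e. \<open>0\<close> or a.e. \<open>\<infinity>\<close> also belong to these classes. For them a weighted integral inequality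
  whose left-hand side is finite reads \<open>0 \<le> C * _\<close>, so they impose nothing.
\<close>

definition A_p :: "real \<Rightarrow> ('a::euclidean_space \<Rightarrow> ennreal) set" where
  "A_p p = {w \<in> weights.
     (SUP B \<in> balls. avg B w
        * enn_powr (avg B (\<lambda>x. enn_powr (w x) (1 - p / (p - 1)))) (p - 1)) < \<infinity>}"

definition essinf_on :: "'a::euclidean_space set \<Rightarrow> ('a \<Rightarrow> ennreal) \<Rightarrow> ennreal" where
  "essinf_on B w = Sup {c. AE x in lebesgue. x \<in> B \<longrightarrow> c \<le> w x}"

definition A_1 :: "('a::euclidean_space \<Rightarrow> ennreal) set" where
  "A_1 = {w \<in> weights. (SUP B \<in> balls. avg B w / essinf_on B w) < \<infinity>}"


subsection \<open>Inequalities over a family of pairs\<close>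

text \<open>
  \<open>\<Phi> f \<le> C \<Phi> g\<close> for \<open>(f,g) \<in> F\<close>: it is claimed only for pairs with finite left-hand side, and
  \<open>C\<close> does not depend on the pair (but may depend on \<open>\<Phi>\<close>, i.e. on the weight and the exponent).
\<close>

definition family_ineq ::
    "(('a \<Rightarrow> ennreal) \<times> ('a \<Rightarrow> ennreal)) set \<Rightarrow> (('a \<Rightarrow> ennreal) \<Rightarrow> ennreal) \<Rightarrow> bool" where
  "family_ineq F \<Phi> \<longleftrightarrow>
     (\<exists>C::real. 0 < C \<and> (\<forall>(f, g) \<in> F. \<Phi> f < \<infinity> \<longrightarrow> \<Phi> f \<le> ennreal C * \<Phi> g))"

end

theory Submission
  imports Defs
begin

text \<open>
  Let \<open>f w\<close> have norm 1. By duality there is an \<open>h\<close> with \<open>h w\<^sup>-\<^sup>1\<close> in the unit ball of \<open>L\<^sup>p\<^sup>'\<close> and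
  \<open>\<integral> f h\<close> bounded below. Because the maximal operator is bounded on \<open>L\<^sup>p\<^sup>'(w\<^sup>-\<^sup>1)\<close>, the Rubio de
  Francia algorithm (lemma \<open>Rubio_de_Francia\<close>) provides a majorant \<open>R\<^sub>2 \<ge> h\<close> of comparable norm with
  \<open>M R\<^sub>2 \<le> C R\<^sub>2\<close>, i.e. an \<open>A\<^sub>1\<close> weight. If the weighted inequalities are known for \<open>A\<^sub>1\<close>, then
  \<open>\<integral> f h \<le> \<integral> f R\<^sub>2 \<le> C \<integral> g R\<^sub>2\<close>, and Hoelder's inequality bounds the right-hand side by the norm
  of \<open>g w\<close>. If they are known for \<open>A\<^sub>P\<close> with \<open>P > 1\<close>, then boundedness on \<open>L\<^sup>p(w)\<close> provides a
  majorant \<open>R\<^sub>1\<close> of \<open>f\<close> and \<open>g\<close> of the same kind, the weight \<open>R\<^sub>1\<^sup>1\<^sup>-\<^sup>P R\<^sub>2\<close> is in \<open>A\<^sub>P\<close> (lemma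
  \<open>A_p_of_HL_max_le\<close>), and the integrals of \<open>f\<^sup>P\<close> and \<open>g\<^sup>P\<close> against it are controlled by \<open>\<integral> R\<^sub>1 R\<^sub>2\<close>.

  The weight in this argument depends on the pair \<open>(f, g)\<close>, whereas the hypothesis allows a
  different constant for every weight, not only a constant that depends on its Muckenhoupt
  characteristic. Uniformity in the pair is obtained by contradiction. If the conclusion fails,
  there are pairs \<open>(f\<^sub>k, g\<^sub>k)\<close> for which it fails with constants \<open>N\<^sub>k\<close> that grow as fast as desired
  (lemma \<open>counterexample_sequence\<close>). The algorithm is applied once, to a sum with geometric
  weights over all \<open>k\<close>; this gives one weight, hence one constant, for all pairs. The geometric
  weights cost a factor exponential in \<open>k\<close>, which \<open>N\<^sub>k\<close> beats (theorems \<open>extrapolation_from_A_1\<close>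
  and \<open>extrapolation_from_A_p\<close>).
\<close>

section \<open>Powers of extended non-negative numbers\<close>

lemma enn_powr_ennreal: "0 < r \<Longrightarrow> enn_powr (ennreal r) a = ennreal (r powr a)"
  by (simp add: enn_powr_def)

lemma enn_powr_one [simp]: "enn_powr t 1 = t"
  by (cases t) (auto simp: enn_powr_def)

lemma enn_powr_zero_base: "0 < a \<Longrightarrow> enn_powr 0 a = 0"
  by (simp add: enn_powr_def)

lemma enn_powr_eq_top: "0 < a \<Longrightarrow> enn_powr t a = top \<longleftrightarrow> t = top"
  by (simp add: enn_powr_def)

lemma enn_powr_eq_0: "0 < a \<Longrightarrow> enn_powr t a = 0 \<longleftrightarrow> t = 0"
  by (cases t) (auto simp: enn_powr_def)

lemma enn_powr_mono:
  assumes "0 \<le> a" "s \<le> t"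
  shows "enn_powr s a \<le> enn_powr t a"
proof (cases t)
  case (real t')
  then obtain s' where s: "s = ennreal s'" "0 \<le> s'"
    using assms(2) by (cases s) (auto simp: top_unique)
  with real assms show ?thesis
    by (auto simp: enn_powr_def ennreal_le_iff intro!: powr_mono2)
next
  case top
  with assms show ?thesis by (auto simp: enn_powr_def)
qed

lemma enn_powr_mult:
  assumes "0 < a"
  shows "enn_powr (s * t) a = enn_powr s a * enn_powr t a"
proof -
  consider "s = 0 \<or> t = 0" | "s \<noteq> 0" "t \<noteq> 0" "s = \<infinity> \<or> t = \<infinity>"
    | s' t' where "s = ennreal s'" "t = ennreal t'" "0 < s'" "0 < t'"
    by (cases s; cases t) (auto simp: ennreal_eq_0_iff not_le, (metis less_eq_real_def)+)
  then show ?thesis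
  proof cases
    case 1 with assms show ?thesis by (auto simp: enn_powr_zero_base)
  next
    case 2
    then have "s * t = \<infinity>" by (auto simp: ennreal_mult_eq_top_iff)
    moreover have "enn_powr s a * enn_powr t a = \<infinity>"
    proof -
      have "enn_powr s a \<noteq> 0" "enn_powr t a \<noteq> 0" "enn_powr s a = \<infinity> \<or> enn_powr t a = \<infinity>"
        using 2 assms by (auto simp: enn_powr_eq_top enn_powr_eq_0)
      then show ?thesis by (auto simp: ennreal_mult_eq_top_iff)
    qed
    ultimately show ?thesis using assms by (simp add: enn_powr_def)
  next
    case 3
    then show ?thesis
      by (simp add: enn_powr_ennreal powr_mult flip: ennreal_mult)
  qed
qed

lemma enn_powr_powr:
  assumes "a \<noteq> 0" "b \<noteq> 0"
  shows "enn_powr (enn_powr t a) b = enn_powr t (a * b)"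
proof -
  consider "t = 0" | "t = \<infinity>" | t' where "t = ennreal t'" "0 < t'"
    by (cases t) (auto simp: less_le)
  then show ?thesis
    using assms
    by cases (auto simp: enn_powr_def zero_less_mult_iff mult_less_0_iff powr_powr not_less)
qed

lemma enn_powr_add:
  assumes "0 < a" "0 < b"
  shows "enn_powr t (a + b) = enn_powr t a * enn_powr t b"
proof -
  consider "t = 0" | "t = \<infinity>" | t' where "t = ennreal t'" "0 < t'"
    by (cases t) (auto simp: less_le)
  then show ?thesis
    using assms
    by cases (auto simp: enn_powr_def powr_add ennreal_mult)
qed

lemma enn_powr_le_self:
  assumes "c \<le> 1" "1 \<le> a"
  shows "enn_powr c a \<le> c"
proof -
  consider "c = 0" | c' where "c = ennreal c'" "0 < c'" "c' \<le> 1"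
    using assms(1) by (cases c) (auto simp: less_le top_unique)
  then show ?thesis
  proof cases
    case 1 then show ?thesis using assms by (simp add: enn_powr_def)
  next
    case 2
    then show ?thesis
      using assms powr_mono'[of 1 a c'] by (simp add: enn_powr_ennreal ennreal_le_iff)
  qed
qed

lemma borel_measurable_enn_powr [measurable]:
  assumes [measurable]: "f \<in> borel_measurable M" "e \<in> borel_measurable M"
  shows "(\<lambda>x. enn_powr (f x) (e x)) \<in> borel_measurable M"
  unfolding enn_powr_def by measurable

section \<open>Unit balls of variable Lebesgue norms\<close>

text \<open>
  Up to a factor of 2 this is the unit ball of the variable Lebesgue norm. The two conditions
  replace the single bound on the sum of the integral and the essential supremum, so that each of
  them can be verified separately and almost everywhere. Since the extrapolation argument
  tolerates absolute constants, all norm estimates are stated as membership in this set.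
\<close>

definition var_ball :: "('a::euclidean_space \<Rightarrow> ennreal) \<Rightarrow> ('a \<Rightarrow> ennreal) \<Rightarrow> bool" where
  "var_ball p f \<longleftrightarrow>
     (\<integral>\<^sup>+x\<in>{x. p x \<noteq> \<infinity>}. enn_powr (f x) (enn2real (p x)) \<partial>lebesgue) \<le> 1 \<and>
     (AE x in lebesgue. p x = \<infinity> \<longrightarrow> f x \<le> 1)"

lemma var_exponents_measurable [measurable_dest]:
  "p \<in> var_exponents \<Longrightarrow> p \<in> borel_measurable lebesgue"
  by (simp add: var_exponents_def)

lemma var_exponents_ge_1: "p \<in> var_exponents \<Longrightarrow> 1 \<le> p x"
  by (simp add: var_exponents_def)

lemma enn2real_exponent_ge_1:
  assumes "p \<in> var_exponents" "p x \<noteq> \<infinity>"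
  shows "1 \<le> enn2real (p x)"
  using var_exponents_ge_1[OF assms(1), of x] assms(2)
  by (cases "p x") (auto simp: ennreal_le_iff simp flip: ennreal_1)

lemma sets_exponent_infinite:
  assumes "p \<in> var_exponents"
  shows "{x. p x = \<infinity>} \<in> sets lebesgue"
proof -
  note [measurable] = var_exponents_measurable[OF assms]
  have "p -` {\<infinity>} \<inter> space lebesgue \<in> sets lebesgue" by measurable
  then show ?thesis by (simp add: vimage_def)
qed

lemma ennreal_half_le_1: "ennreal (1/2) \<le> 1"
  by (subst ennreal_1[symmetric], rule ennreal_leI) simp

lemma ennreal_half_mult_2: "ennreal (1/2) * 2 = 1"
  using ennreal_mult[of "1/2" 2] by simp

lemma esssup_restrict_le:
  fixes f :: "'a \<Rightarrow> ennreal"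
  assumes [measurable]: "f \<in> borel_measurable M" and S: "S \<in> sets M"
    and "AE x in M. x \<in> S \<longrightarrow> f x \<le> c"
  shows "esssup (restrict_space M S) f \<le> c"
  using assms by (intro esssup_I measurable_restrict_space1) (auto simp: AE_restrict_space_iff)

lemma AE_le_esssup_restrict:
  fixes f :: "'a \<Rightarrow> ennreal"
  assumes "S \<in> sets M"
  shows "AE x in M. x \<in> S \<longrightarrow> f x \<le> esssup (restrict_space M S) f"
  using esssup_AE[of f "restrict_space M S"] assms
  by (simp add: AE_restrict_space_iff)

lemma var_ball_mono:
  assumes p: "p \<in> var_exponents" and le: "AE x in lebesgue. f x \<le> g x" and g: "var_ball p g"
  shows "var_ball p f"
  unfolding var_ball_def
proof
  have "(\<integral>\<^sup>+x\<in>{x. p x \<noteq> \<infinity>}. enn_powr (f x) (enn2real (p x)) \<partial>lebesgue)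
      \<le> (\<integral>\<^sup>+x\<in>{x. p x \<noteq> \<infinity>}. enn_powr (g x) (enn2real (p x)) \<partial>lebesgue)"
    using le
    by (intro nn_integral_mono_AE)
      (auto intro!: enn_powr_mono mult_right_mono elim!: eventually_mono)
  also have "\<dots> \<le> 1" using g by (simp add: var_ball_def)
  finally show "(\<integral>\<^sup>+x\<in>{x. p x \<noteq> \<infinity>}. enn_powr (f x) (enn2real (p x)) \<partial>lebesgue) \<le> 1" .
  have "AE x in lebesgue. p x = \<infinity> \<longrightarrow> g x \<le> 1" using g by (simp add: var_ball_def)
  then show "AE x in lebesgue. p x = \<infinity> \<longrightarrow> f x \<le> 1"
    using le by eventually_elim auto
qed

lemma divide_ennreal_as_mult: "0 < r \<Longrightarrow> x / ennreal r = ennreal (1 / r) * x"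
  by (simp add: divide_ennreal_def inverse_ennreal inverse_eq_divide mult.commute)

lemma var_ball_of_var_norm_less:
  assumes p: "p \<in> var_exponents" and less: "var_norm p f < ennreal l"
  shows "var_ball p (\<lambda>x. ennreal (1 / l) * f x)"
proof -
  note [measurable] = var_exponents_measurable[OF p]
  obtain l' where l': "0 < l'" "l' < l"
    and rho: "(\<integral>\<^sup>+x\<in>{x. p x \<noteq> \<infinity>}. enn_powr (f x / ennreal l') (enn2real (p x)) \<partial>lebesgue)
        + esssup (restrict_space lebesgue {x. p x = \<infinity>}) f / ennreal l' \<le> 1"
    using less unfolding var_norm_def INF_less_iff by (auto simp: ennreal_less_iff)
  note S = sets_exponent_infinite[OF p]
  have "var_ball p (\<lambda>x. f x / ennreal l')"
    unfolding var_ball_def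
  proof
    show "(\<integral>\<^sup>+x\<in>{x. p x \<noteq> \<infinity>}. enn_powr (f x / ennreal l') (enn2real (p x)) \<partial>lebesgue) \<le> 1"
      by (rule order_trans[OF _ rho]) simp
    have *: "esssup (restrict_space lebesgue {x. p x = \<infinity>}) f / ennreal l' \<le> 1"
      by (rule order_trans[OF _ rho]) simp
    show "AE x in lebesgue. p x = \<infinity> \<longrightarrow> f x / ennreal l' \<le> 1"
      using AE_le_esssup_restrict[OF S, of f]
    proof eventually_elim
      case (elim x)
      then show ?case
        using order_trans[OF divide_right_mono_ennreal[of "f x"] *] by simp
    qed
  qed
  then show ?thesis
  proof (rule var_ball_mono[OF p, rotated])
    show "AE x in lebesgue. ennreal (1 / l) * f x \<le> f x / ennreal l'"
    proof (intro AE_I2)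
      fix x
      have "ennreal (1 / l) \<le> ennreal (1 / l')"
        using l' by (intro ennreal_leI) (simp add: frac_le)
      then show "ennreal (1 / l) * f x \<le> f x / ennreal l'"
        using l' by (simp add: divide_ennreal_as_mult mult_right_mono)
    qed
  qed
qed

text \<open>
  The integral and the essential supremum are bounded separately in \<open>var_ball\<close>; dividing by
  a further factor 2 makes each of them at most 1/2, by convexity of \<open>t \<mapsto> t\<^sup>p\<close>.
\<close>

lemma var_norm_le_of_var_ball:
  assumes p: "p \<in> var_exponents" and [measurable]: "f \<in> borel_measurable lebesgue"
    and l: "0 < l" and ball: "var_ball p (\<lambda>x. ennreal (1 / l) * f x)"
  shows "var_norm p f \<le> ennreal (2 * l)"
proof -
  note [measurable] = var_exponents_measurable[OF p]
  let ?h = "ennreal (1 / 2)"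
  have scale: "t / ennreal (2 * l) = ?h * (ennreal (1 / l) * t)" for t
  proof -
    have "t / ennreal (2 * l) = ennreal (1 / 2 * (1 / l)) * t"
      using l by (subst divide_ennreal_as_mult) simp_all
    also have "\<dots> = ?h * (ennreal (1 / l) * t)"
      using l by (subst ennreal_mult) (simp_all add: mult.assoc)
    finally show ?thesis .
  qed
  have half: "?h + ?h = 1" by (subst ennreal_plus[symmetric]) simp_all
  have "(\<integral>\<^sup>+x\<in>{x. p x \<noteq> \<infinity>}. enn_powr (f x / ennreal (2 * l)) (enn2real (p x)) \<partial>lebesgue)
     \<le> (\<integral>\<^sup>+x. ?h * (enn_powr (ennreal (1 / l) * f x) (enn2real (p x)) * indicator {x. p x \<noteq> \<infinity>} x) \<partial>lebesgue)"
  proof (intro nn_integral_mono)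
    fix x
    show "enn_powr (f x / ennreal (2 * l)) (enn2real (p x)) * indicator {x. p x \<noteq> \<infinity>} x
      \<le> ?h * (enn_powr (ennreal (1 / l) * f x) (enn2real (p x)) * indicator {x. p x \<noteq> \<infinity>} x)"
    proof (cases "p x = \<infinity>")
      case False
      note e = enn2real_exponent_ge_1[OF p False]
      from enn_powr_le_self[OF ennreal_half_le_1 e] e show ?thesis
        by (simp add: scale enn_powr_mult mult_right_mono mult.assoc[symmetric])
    qed simp
  qed
  also have "\<dots> = ?h * (\<integral>\<^sup>+x\<in>{x. p x \<noteq> \<infinity>}. enn_powr (ennreal (1 / l) * f x) (enn2real (p x)) \<partial>lebesgue)"
    by (intro nn_integral_cmult) measurable
  also have "\<dots> \<le> ?h * 1"
    using ball by (intro mult_left_mono) (simp_all add: var_ball_def)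
  finally have 1: "(\<integral>\<^sup>+x\<in>{x. p x \<noteq> \<infinity>}. enn_powr (f x / ennreal (2 * l)) (enn2real (p x)) \<partial>lebesgue) \<le> ?h"
    by simp
  have "AE x in lebesgue. p x = \<infinity> \<longrightarrow> ennreal (1 / l) * f x \<le> 1"
    using ball by (simp add: var_ball_def)
  then have "AE x in lebesgue. x \<in> {x. p x = \<infinity>} \<longrightarrow> f x \<le> ennreal l"
  proof (eventually_elim, intro impI)
    fix x assume "p x = \<infinity> \<longrightarrow> ennreal (1 / l) * f x \<le> 1" "x \<in> {x. p x = \<infinity>}"
    then have "ennreal l * (ennreal (1 / l) * f x) \<le> ennreal l * 1"
      by (intro mult_left_mono) auto
    then show "f x \<le> ennreal l"
      using l by (simp add: mult.assoc[symmetric] flip: ennreal_mult)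
  qed
  then have "esssup (restrict_space lebesgue {x. p x = \<infinity>}) f \<le> ennreal l"
    by (intro esssup_restrict_le sets_exponent_infinite p) auto
  then have "esssup (restrict_space lebesgue {x. p x = \<infinity>}) f / ennreal (2 * l) \<le> ennreal l / ennreal (2 * l)"
    by (rule divide_right_mono_ennreal)
  also have "\<dots> = ?h" using l by (simp add: divide_ennreal)
  finally have "(\<integral>\<^sup>+x\<in>{x. p x \<noteq> \<infinity>}. enn_powr (f x / ennreal (2 * l)) (enn2real (p x)) \<partial>lebesgue)
        + esssup (restrict_space lebesgue {x. p x = \<infinity>}) f / ennreal (2 * l) \<le> 1"
    unfolding half[symmetric] by (intro add_mono 1)
  then show ?thesis
    unfolding var_norm_def using l by (intro INF_lower2[of "2 * l"]) simp_all
qed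

lemma var_ball_finite_AE:
  assumes p: "p \<in> var_exponents" and [measurable]: "f \<in> borel_measurable lebesgue"
    and ball: "var_ball p f"
  shows "AE x in lebesgue. f x < \<infinity>"
proof -
  note [measurable] = var_exponents_measurable[OF p]
  have "AE x in lebesgue. enn_powr (f x) (enn2real (p x)) * indicator {x. p x \<noteq> \<infinity>} x \<noteq> \<infinity>"
    using ball by (intro nn_integral_noteq_infinite) (auto simp: var_ball_def top_unique)
  moreover have "AE x in lebesgue. p x = \<infinity> \<longrightarrow> f x \<le> 1"
    using ball by (simp add: var_ball_def)
  ultimately show ?thesis
  proof eventually_elim
    case (elim x)
    show ?case
    proof (cases "p x = \<infinity>")
      case True
      with elim show ?thesis using le_less_trans[of "f x" 1 \<infinity>] by simp
    next
      case False
      have "0 < enn2real (p x)" using enn2real_exponent_ge_1[OF p False] by simp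
      with elim(1) False have "f x \<noteq> top" by (auto simp: enn_powr_eq_top)
      then show ?thesis by (simp add: less_top)
    qed
  qed
qed

lemma suminf_quarter_powers: "(\<Sum>k. ennreal ((1/4)^k)) = ennreal (4/3)"
proof -
  have "(\<lambda>k. (1/4::real)^k) sums (4/3)"
    using geometric_sums[of "1/4::real"] by simp
  then show ?thesis by (intro suminf_ennreal_eq) auto
qed

lemma suminf_half_powers: "(\<Sum>k. ennreal ((1/2)^k)) = 2"
proof -
  have "(\<lambda>k. (1/2::real)^k) sums 2"
    using geometric_sums[of "1/2::real"] by simp
  then have "(\<Sum>k. ennreal ((1/2)^k)) = ennreal 2" by (intro suminf_ennreal_eq) auto
  then show ?thesis by simp
qed

text \<open>
  A convexity estimate. Writing \<open>4\<^sup>-\<^sup>k = 2\<^sup>-\<^sup>k 2\<^sup>-\<^sup>k\<close> leaves room to replace Jensen's inequality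
  for series by the trivial remark that each term \<open>(2\<^sup>-\<^sup>k f\<^sub>k)\<^sup>a \<le> 2\<^sup>-\<^sup>k f\<^sub>k\<^sup>a\<close> is at most the sum
  of all of them.
\<close>

lemma enn_powr_suminf_le:
  assumes a: "1 \<le> a"
  shows "enn_powr (ennreal (1/4) * (\<Sum>k. ennreal ((1/4)^k) * f k)) a
    \<le> ennreal (1/2) * (\<Sum>k. ennreal ((1/2)^k) * enn_powr (f k) a)"
proof -
  define S where "S = (\<Sum>k. ennreal ((1/2)^k) * enn_powr (f k) a)"
  have term_le: "ennreal ((1/2)^k) * f k \<le> enn_powr S (1 / a)" for k
  proof -
    have "(1/2::real)^k \<le> 1" by (simp add: power_le_one)
    then have "ennreal ((1/2)^k) \<le> 1" by (simp flip: ennreal_1)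
    from enn_powr_le_self[OF this a]
    have "enn_powr (ennreal ((1/2)^k) * f k) a \<le> ennreal ((1/2)^k) * enn_powr (f k) a"
      using a by (simp add: enn_powr_mult mult_right_mono)
    also have "\<dots> \<le> S"
      unfolding S_def using sum_le_suminf[OF summableI, of "{k}" "\<lambda>k. ennreal ((1/2)^k) * enn_powr (f k) a"]
      by simp
    finally have "enn_powr (enn_powr (ennreal ((1/2)^k) * f k) a) (1 / a) \<le> enn_powr S (1 / a)"
      using a by (intro enn_powr_mono) auto
    then show ?thesis using a by (simp add: enn_powr_powr)
  qed
  have "ennreal ((1/4)^k) = ennreal ((1/2)^k) * ennreal ((1/2)^k)" for k
    by (subst ennreal_mult[symmetric]) (simp_all flip: power_mult_distrib)
  then have "(\<Sum>k. ennreal ((1/4)^k) * f k) = (\<Sum>k. ennreal ((1/2)^k) * (ennreal ((1/2)^k) * f k))"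
    by (simp only: mult.assoc)
  also have "\<dots> \<le> (\<Sum>k. ennreal ((1/2)^k) * enn_powr S (1 / a))"
    by (intro suminf_le summableI mult_left_mono term_le) auto
  also have "\<dots> = 2 * enn_powr S (1 / a)"
    by (simp add: suminf_half_powers)
  finally have "ennreal (1/4) * (\<Sum>k. ennreal ((1/4)^k) * f k) \<le> ennreal (1/4) * (2 * enn_powr S (1 / a))"
    by (intro mult_left_mono) auto
  also have "\<dots> = ennreal (1/4 * 2) * enn_powr S (1 / a)"
    by (subst ennreal_mult) (simp_all add: mult.assoc)
  finally have "enn_powr (ennreal (1/4) * (\<Sum>k. ennreal ((1/4)^k) * f k)) a
      \<le> enn_powr (ennreal (1/2) * enn_powr S (1 / a)) a"
    using a by (intro enn_powr_mono) auto
  also have "\<dots> = enn_powr (ennreal (1/2)) a * S"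
    using a by (simp add: enn_powr_mult enn_powr_powr)
  also have "\<dots> \<le> ennreal (1/2) * S"
    using a by (intro mult_right_mono enn_powr_le_self ennreal_half_le_1) auto
  finally show ?thesis by (simp add: S_def)
qed

text \<open>
  A substitute for the triangle inequality for series, with weights \<open>4\<^sup>-\<^sup>k\<close>.
\<close>

lemma var_ball_suminf:
  assumes p: "p \<in> var_exponents" and [measurable]: "\<And>k. f k \<in> borel_measurable lebesgue"
    and ball: "\<And>k. var_ball p (f k)"
  shows "var_ball p (\<lambda>x. ennreal (1/4) * (\<Sum>k. ennreal ((1/4)^k) * f k x))"
  unfolding var_ball_def
proof
  note [measurable] = var_exponents_measurable[OF p]
  let ?I = "\<lambda>k x. enn_powr (f k x) (enn2real (p x)) * indicator {x. p x \<noteq> \<infinity>} x"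
  have "(\<integral>\<^sup>+x\<in>{x. p x \<noteq> \<infinity>}. enn_powr (ennreal (1/4) * (\<Sum>k. ennreal ((1/4)^k) * f k x)) (enn2real (p x)) \<partial>lebesgue)
      \<le> (\<integral>\<^sup>+x. ennreal (1/2) * (\<Sum>k. ennreal ((1/2)^k) * ?I k x) \<partial>lebesgue)"
  proof (intro nn_integral_mono)
    fix x
    show "enn_powr (ennreal (1/4) * (\<Sum>k. ennreal ((1/4)^k) * f k x)) (enn2real (p x)) * indicator {x. p x \<noteq> \<infinity>} x
        \<le> ennreal (1/2) * (\<Sum>k. ennreal ((1/2)^k) * ?I k x)"
      using enn_powr_suminf_le[OF enn2real_exponent_ge_1[OF p], of x "\<lambda>k. f k x"]
      by (cases "p x = \<infinity>") auto
  qed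
  also have "\<dots> = ennreal (1/2) * (\<Sum>k. ennreal ((1/2)^k) * (\<integral>\<^sup>+x. ?I k x \<partial>lebesgue))"
    by (subst nn_integral_cmult, measurable, subst nn_integral_suminf, measurable, subst nn_integral_cmult, measurable)
  also have "\<dots> \<le> ennreal (1/2) * (\<Sum>k. ennreal ((1/2)^k) * 1)"
    using ball by (intro mult_left_mono suminf_le summableI) (auto simp: var_ball_def)
  also have "\<dots> = 1"
    unfolding mult_1_right suminf_half_powers by (rule ennreal_half_mult_2)
  finally show "(\<integral>\<^sup>+x\<in>{x. p x \<noteq> \<infinity>}. enn_powr (ennreal (1/4) * (\<Sum>k. ennreal ((1/4)^k) * f k x)) (enn2real (p x)) \<partial>lebesgue) \<le> 1" .
  have "AE x in lebesgue. \<forall>k. p x = \<infinity> \<longrightarrow> f k x \<le> 1"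
    using ball by (subst AE_all_countable) (simp add: var_ball_def)
  then show "AE x in lebesgue. p x = \<infinity> \<longrightarrow> ennreal (1/4) * (\<Sum>k. ennreal ((1/4)^k) * f k x) \<le> 1"
  proof (eventually_elim, intro impI)
    fix x assume *: "\<forall>k. p x = \<infinity> \<longrightarrow> f k x \<le> 1" "p x = \<infinity>"
    have "(\<Sum>k. ennreal ((1/4)^k) * f k x) \<le> (\<Sum>k. ennreal ((1/4)^k) * 1)"
      using * by (intro suminf_le summableI mult_left_mono) auto
    also have "\<dots> = ennreal (4/3)" by (simp add: suminf_quarter_powers)
    finally have "ennreal (1/4) * (\<Sum>k. ennreal ((1/4)^k) * f k x) \<le> ennreal (1/4) * ennreal (4/3)"
      by (intro mult_left_mono) auto
    also have "\<dots> \<le> 1"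
      by (simp flip: ennreal_mult ennreal_1)
    finally show "ennreal (1/4) * (\<Sum>k. ennreal ((1/4)^k) * f k x) \<le> 1" .
  qed
qed

section \<open>Hoelder inequality and duality\<close>

lemma conj_exponent_cases:
  assumes p: "1 \<le> p x"
  obtains (infinity) "p x = \<infinity>" "conj_exponent p x = 1"
    | (one) "p x = 1" "conj_exponent p x = \<infinity>"
    | (between) P where "1 < P" "p x = ennreal P" "conj_exponent p x = ennreal (P / (P - 1))"
proof (cases "p x")
  case top
  then have "conj_exponent p x = 1" by (simp add: conj_exponent_def)
  with top infinity show ?thesis by simp
next
  case (real P)
  with p have "1 \<le> P" by (simp flip: ennreal_1)
  then consider "P = 1" | "1 < P" by fastforce
  then show ?thesis
  proof cases
    case 1
    then have "p x = 1" using real by simp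
    moreover from this have "conj_exponent p x = \<infinity>" by (simp add: conj_exponent_def)
    ultimately show ?thesis by (rule one)
  next
    case 2
    have "1 / p x = ennreal (1 / P)"
      using real 2 by (simp add: divide_ennreal flip: ennreal_1)
    then have "1 - 1 / p x = ennreal (1 - 1 / P)"
      using 2 by (simp add: ennreal_minus flip: ennreal_1)
    moreover have "0 < 1 - 1 / P" using 2 by simp
    ultimately have "conj_exponent p x = ennreal (1 / (1 - 1 / P))"
      by (simp add: conj_exponent_def divide_ennreal flip: ennreal_1)
    moreover have "1 / (1 - 1 / P) = P / (P - 1)" using 2 by (simp add: field_simps)
    ultimately show ?thesis using between real 2 by simp
  qed
qed

lemma conj_exponent_in_var_exponents:
  assumes p: "p \<in> var_exponents"
  shows "conj_exponent p \<in> var_exponents"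
proof -
  note [measurable] = var_exponents_measurable[OF p]
  have "1 \<le> conj_exponent p x" for x
    using var_exponents_ge_1[OF p, of x]
    by (cases rule: conj_exponent_cases[of p x]) (auto simp flip: ennreal_1)
  moreover have "conj_exponent p \<in> borel_measurable lebesgue"
    unfolding conj_exponent_def by measurable
  ultimately show ?thesis by (simp add: var_exponents_def)
qed

text \<open>
  Young's inequality without the sharp constants: whichever of \<open>s\<^sup>P\<close> and \<open>t\<^sup>P\<^sup>/\<^sup>(\<^sup>P\<^sup>-\<^sup>1\<^sup>)\<close> is the larger
  dominates the product by itself.
\<close>

lemma mult_le_enn_powr_add_conj:
  assumes P: "1 < P"
  shows "s * t \<le> enn_powr s P + enn_powr t (P / (P - 1))"
proof (cases "s \<le> enn_powr t (1 / (P - 1))")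
  case True
  have "1 / (P - 1) + 1 = P / (P - 1)" using P by (simp add: field_simps)
  then have "enn_powr t (P / (P - 1)) = enn_powr t (1 / (P - 1)) * t"
    using P enn_powr_add[of "1 / (P - 1)" 1 t] by simp
  then show ?thesis
    using mult_right_mono[OF True, of t] by (simp add: add_increasing)
next
  case False
  then have "enn_powr (enn_powr t (1 / (P - 1))) (P - 1) \<le> enn_powr s (P - 1)"
    using P by (intro enn_powr_mono) auto
  then have "t \<le> enn_powr s (P - 1)" using P by (simp add: enn_powr_powr)
  then have "s * t \<le> enn_powr s 1 * enn_powr s (P - 1)" by (simp add: mult_left_mono)
  also have "\<dots> = enn_powr s P" using P by (subst enn_powr_add[symmetric]) auto
  finally show ?thesis by (simp add: add_increasing2)
qed

text \<open>
  Hoelder's inequality. It is pointwise: Young's inequality where \<open>1 < p < \<infinity>\<close>, and on the sets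
  \<open>p = 1\<close> and \<open>p = \<infinity>\<close> one factor is bounded by 1 and the other one enters with exponent 1.
\<close>

lemma nn_integral_mult_le_of_var_ball:
  assumes p: "p \<in> var_exponents"
    and [measurable]: "f \<in> borel_measurable lebesgue" "g \<in> borel_measurable lebesgue"
    and f: "var_ball p f" and g: "var_ball (conj_exponent p) g"
  shows "(\<integral>\<^sup>+x. f x * g x \<partial>lebesgue) \<le> 2"
proof -
  let ?q = "conj_exponent p"
  note [measurable] = var_exponents_measurable[OF p]
    var_exponents_measurable[OF conj_exponent_in_var_exponents[OF p]]
  let ?F = "\<lambda>x. enn_powr (f x) (enn2real (p x)) * indicator {x. p x \<noteq> \<infinity>} x"
  let ?G = "\<lambda>x. enn_powr (g x) (enn2real (?q x)) * indicator {x. ?q x \<noteq> \<infinity>} x"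
  have "AE x in lebesgue. p x = \<infinity> \<longrightarrow> f x \<le> 1" "AE x in lebesgue. ?q x = \<infinity> \<longrightarrow> g x \<le> 1"
    using f g by (simp_all add: var_ball_def)
  then have "AE x in lebesgue. f x * g x \<le> ?F x + ?G x"
  proof eventually_elim
    case (elim x)
    from var_exponents_ge_1[OF p, of x] show ?case
    proof (cases rule: conj_exponent_cases[of p x])
      case infinity
      then show ?thesis using elim mult_right_mono[of "f x" 1 "g x"] by simp
    next
      case one
      then show ?thesis using elim mult_left_mono[of "g x" 1 "f x"] by simp
    next
      case (between P)
      then show ?thesis using mult_le_enn_powr_add_conj[of P "f x" "g x"] by simp
    qed
  qed
  then have "(\<integral>\<^sup>+x. f x * g x \<partial>lebesgue) \<le> (\<integral>\<^sup>+x. ?F x + ?G x \<partial>lebesgue)"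
    by (rule nn_integral_mono_AE)
  also have "\<dots> = (\<integral>\<^sup>+x. ?F x \<partial>lebesgue) + (\<integral>\<^sup>+x. ?G x \<partial>lebesgue)"
    by (rule nn_integral_add) measurable
  also have "\<dots> \<le> 1 + 1"
    using f g by (intro add_mono) (auto simp: var_ball_def)
  finally show ?thesis by simp
qed

text \<open>
  The integral over \<open>E\<close> is finite, so that one can divide by it, and still exceeds 1.
\<close>

lemma nn_integral_truncation:
  fixes g :: "'a::euclidean_space \<Rightarrow> ennreal"
  assumes [measurable]: "g \<in> borel_measurable lebesgue"
    and fin: "AE x in lebesgue. g x < \<infinity>" and less: "1 < (\<integral>\<^sup>+x. g x \<partial>lebesgue)"
  obtains E A where "E \<in> sets lebesgue" "1 < A" "(\<integral>\<^sup>+x\<in>E. g x \<partial>lebesgue) = ennreal A"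
proof -
  define E where "E n = {x \<in> cball 0 (real n). g x \<le> of_nat n}" for n :: nat
  have cball [measurable]: "cball 0 r \<in> sets lebesgue" for r :: real
    using lmeasurable_cball by (rule fmeasurableD)
  have E [measurable]: "E n \<in> sets lebesgue" for n
  proof -
    have "cball 0 (real n) \<inter> (g -` {..of_nat n} \<inter> space lebesgue) \<in> sets lebesgue" by measurable
    moreover have "E n = cball 0 (real n) \<inter> (g -` {..of_nat n} \<inter> space lebesgue)"
      by (auto simp: E_def)
    ultimately show ?thesis by simp
  qed
  have "AE x in lebesgue. g x \<le> (SUP n. g x * indicator (E n) x)"
    using fin
  proof eventually_elim
    case (elim x)
    then obtain r where r: "g x = ennreal r" "0 \<le> r" by (cases "g x") auto
    obtain n :: nat where "max r (norm x) \<le> real n" using real_arch_simple by blast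
    then have "x \<in> E n"
      using r by (simp add: E_def ennreal_of_nat_eq_real_of_nat)
    then show ?case by (intro SUP_upper2[of n]) auto
  qed
  then have "(\<integral>\<^sup>+x. g x \<partial>lebesgue) \<le> (\<integral>\<^sup>+x. (SUP n. g x * indicator (E n) x) \<partial>lebesgue)"
    by (rule nn_integral_mono_AE)
  also have "\<dots> = (SUP n. \<integral>\<^sup>+x. g x * indicator (E n) x \<partial>lebesgue)"
  proof (rule nn_integral_monotone_convergence_SUP)
    have "E m \<subseteq> E n" if "m \<le> n" for m n
      using that by (auto simp: E_def elim!: order_trans)
    then show "incseq (\<lambda>n x. g x * indicator (E n) x)"
      by (intro monoI le_funI mult_left_mono) (auto simp: indicator_def subset_eq)
  qed measurable
  finally have "(\<integral>\<^sup>+x. g x \<partial>lebesgue) \<le> (SUP n. \<integral>\<^sup>+x. g x * indicator (E n) x \<partial>lebesgue)" .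
  from less_le_trans[OF less this] obtain n
    where n: "1 < (\<integral>\<^sup>+x. g x * indicator (E n) x \<partial>lebesgue)"
    by (auto simp: less_SUP_iff)
  have "(\<integral>\<^sup>+x. g x * indicator (E n) x \<partial>lebesgue) \<le> (\<integral>\<^sup>+x. of_nat n * indicator (cball 0 (real n)) (x :: 'a) \<partial>lebesgue)"
    by (intro nn_integral_mono) (auto simp: E_def indicator_def)
  also have "\<dots> = of_nat n * emeasure lebesgue (cball 0 (real n) :: 'a set)"
    by (rule nn_integral_cmult_indicator) measurable
  also have "\<dots> < \<infinity>"
    using fmeasurableD2[OF lmeasurable_cball, of "0 :: 'a" "real n"]
    by (simp add: ennreal_mult_less_top less_top of_nat_less_top)
  finally obtain A where A: "(\<integral>\<^sup>+x. g x * indicator (E n) x \<partial>lebesgue) = ennreal A" "0 \<le> A"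
    by (cases "\<integral>\<^sup>+x. g x * indicator (E n) x \<partial>lebesgue") auto
  with n have "1 < A" by (simp flip: ennreal_1 add: ennreal_less_iff)
  with that[OF E this A(1)] show ?thesis by simp
qed

text \<open>
  The norm is attained, up to a constant, by duality. If the integral of \<open>f\<^sup>p\<close> is too large, then
  \<open>h\<close> is the usual extremal function \<open>f\<^sup>p\<^sup>-\<^sup>1\<close>, cut off to a set \<open>E\<close> on which \<open>f\<^sup>p\<close> has a finite
  integral \<open>A > 1\<close>, and divided by \<open>A\<close>. If \<open>f > 1\<close> on a non-null subset of \<open>p = \<infinity>\<close>, then
  \<open>h\<close> is a normalised indicator of a part of that set.
\<close>

lemma var_ball_dual:
  assumes p: "p \<in> var_exponents" and [measurable]: "f \<in> borel_measurable lebesgue"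
    and fin: "AE x in lebesgue. f x < \<infinity>" and not_ball: "\<not> var_ball p f"
  obtains h where "h \<in> borel_measurable lebesgue" "var_ball (conj_exponent p) h"
    "1 \<le> (\<integral>\<^sup>+x. f x * h x \<partial>lebesgue)"
proof -
  let ?q = "conj_exponent p"
  note [measurable] = var_exponents_measurable[OF p]
    var_exponents_measurable[OF conj_exponent_in_var_exponents[OF p]]
  have S: "{x. p x = \<infinity>} \<in> sets lebesgue" by (rule sets_exponent_infinite[OF p])
  let ?g = "\<lambda>x. enn_powr (f x) (enn2real (p x)) * indicator {x. p x \<noteq> \<infinity>} x"
  have scaled: "ennreal (1 / A) * (\<integral>\<^sup>+x\<in>E. g x \<partial>lebesgue) = 1"
    if "1 < A" "(\<integral>\<^sup>+x\<in>E. g x \<partial>lebesgue) = ennreal A" for A E and g :: "'a \<Rightarrow> ennreal"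
    using that by (simp flip: ennreal_mult)
  consider (finite) "1 < (\<integral>\<^sup>+x. ?g x \<partial>lebesgue)" | (infinite) "\<not> (AE x in lebesgue. p x = \<infinity> \<longrightarrow> f x \<le> 1)"
    using not_ball by (auto simp: var_ball_def not_le)
  then show thesis
  proof cases
    case finite
    have "AE x in lebesgue. ?g x < \<infinity>"
      using fin
    proof eventually_elim
      case (elim x)
      show ?case
      proof (cases "p x = \<infinity>")
        case False
        then have "enn_powr (f x) (enn2real (p x)) \<noteq> top"
          using enn2real_exponent_ge_1[OF p False] elim by (simp add: enn_powr_eq_top)
        then show ?thesis by (simp add: less_top indicator_def)
      qed simp
    qed
    moreover have "?g \<in> borel_measurable lebesgue" by measurable
    ultimately obtain E A
      where E [measurable]: "E \<in> sets lebesgue" and A: "1 < A"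
        and gE: "(\<integral>\<^sup>+x\<in>E. ?g x \<partial>lebesgue) = ennreal A"
      using nn_integral_truncation[OF _ _ finite] by blast
    define h where "h x = ennreal (1 / A) *
        (enn_powr (f x) (enn2real (p x) - 1) * indicator {x. p x \<noteq> \<infinity>} x * indicator E x)" for x
    have [measurable]: "h \<in> borel_measurable lebesgue"
      unfolding h_def by measurable
    have le1: "ennreal (1 / A) \<le> 1" using A by (simp flip: ennreal_1)
    have "var_ball ?q h"
      unfolding var_ball_def
    proof
      have "(\<integral>\<^sup>+x\<in>{x. ?q x \<noteq> \<infinity>}. enn_powr (h x) (enn2real (?q x)) \<partial>lebesgue)
          \<le> (\<integral>\<^sup>+x. ennreal (1 / A) * (?g x * indicator E x) \<partial>lebesgue)"
      \<comment> \<open>For \<open>1 < p < \<infinity>\<close> the exponents satisfy \<open>(p - 1) p' = p\<close>, and \<open>A\<^sup>-\<^sup>p\<^sup>' \<le> A\<^sup>-\<^sup>1\<close>.\<close>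
      proof (intro nn_integral_mono)
        fix x
        from var_exponents_ge_1[OF p, of x]
        show "enn_powr (h x) (enn2real (?q x)) * indicator {x. ?q x \<noteq> \<infinity>} x
            \<le> ennreal (1 / A) * (?g x * indicator E x)"
        proof (cases rule: conj_exponent_cases[of p x])
          case (between P)
          then have "1 \<le> P / (P - 1)" by simp
          from enn_powr_le_self[OF le1 this] between show ?thesis
            by (auto simp: h_def enn_powr_mult enn_powr_powr enn_powr_zero_base enn_powr_def[of 1]
                intro!: mult_right_mono split: split_indicator)
        qed (simp_all add: h_def)
      qed
      also have "\<dots> = 1"
        using scaled[OF A gE] by (subst nn_integral_cmult) measurable
      finally show "(\<integral>\<^sup>+x\<in>{x. ?q x \<noteq> \<infinity>}. enn_powr (h x) (enn2real (?q x)) \<partial>lebesgue) \<le> 1" .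
      show "AE x in lebesgue. ?q x = \<infinity> \<longrightarrow> h x \<le> 1"
      proof (intro AE_I2 impI)
        fix x assume "?q x = \<infinity>"
        with var_exponents_ge_1[OF p, of x] have "p x = 1"
          by (cases rule: conj_exponent_cases[of p x]) auto
        then show "h x \<le> 1"
          using le1 by (simp add: h_def enn_powr_def split: split_indicator)
      qed
    qed
    moreover have "f x * h x = ennreal (1 / A) * (?g x * indicator E x)" for x
    proof (cases "p x = \<infinity>")
      case False
      have "f x * enn_powr (f x) (enn2real (p x) - 1) = enn_powr (f x) (enn2real (p x))"
      proof (cases "enn2real (p x) = 1")
        case True
        then show ?thesis by (simp add: enn_powr_def[of _ 0])
      next
        case neq: False
        with enn2real_exponent_ge_1[OF p False] have "1 < enn2real (p x)" by linarith
        then show ?thesis using enn_powr_add[of 1 "enn2real (p x) - 1" "f x"] by simp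
      qed
      then show ?thesis by (simp add: h_def mult.left_commute[of "f x" "ennreal (1 / A)"] split: split_indicator)
    qed (simp add: h_def)
    then have "(\<integral>\<^sup>+x. f x * h x \<partial>lebesgue) = 1"
      using scaled[OF A gE] by (simp only:) (subst nn_integral_cmult; measurable)
    ultimately show thesis by (intro that[of h]) auto
  next
    case infinite
    define U where "U = {x. p x = \<infinity> \<and> 1 < f x}"
    have U [measurable]: "U \<in> sets lebesgue"
    proof -
      have "{x. p x = \<infinity>} \<inter> (f -` {1<..} \<inter> space lebesgue) \<in> sets lebesgue"
        by (intro sets.Int S measurable_sets[of f lebesgue borel]) auto
      moreover have "{x. p x = \<infinity>} \<inter> (f -` {1<..} \<inter> space lebesgue) = U" by (auto simp: U_def)
      ultimately show ?thesis by (simp only:)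
    qed
    have "emeasure lebesgue U \<noteq> 0"
    proof
      assume "emeasure lebesgue U = 0"
      then have "AE x in lebesgue. x \<notin> U" by (intro AE_not_in null_setsI U)
      then have "AE x in lebesgue. p x = \<infinity> \<longrightarrow> f x \<le> 1"
        by eventually_elim (auto simp: U_def not_less)
      with infinite show False ..
    qed
    \<comment> \<open>Any \<open>c\<close> will do that makes the truncation lemma applicable to \<open>c\<close> times the indicator of \<open>U\<close>.\<close>
    then obtain c :: real where c: "0 < c" "1 < ennreal c * emeasure lebesgue U"
    proof (cases "emeasure lebesgue U")
      case (real m)
      with \<open>emeasure lebesgue U \<noteq> 0\<close> have m: "0 < m" by (simp add: less_le)
      have "1 < ennreal (2 / m) * emeasure lebesgue U"
        using m real by (simp flip: ennreal_mult)
      with that[of "2 / m"] m show ?thesis by simp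
    next
      case top
      with that[of 1] show ?thesis by simp
    qed
    have "1 < (\<integral>\<^sup>+x. ennreal c * indicator U x \<partial>lebesgue)"
      using c by (subst nn_integral_cmult_indicator) auto
    moreover have "AE x in lebesgue. ennreal c * indicator U x < \<infinity>"
      by (auto simp: indicator_def)
    moreover have "(\<lambda>x. ennreal c * indicator U x) \<in> borel_measurable lebesgue" by measurable
    ultimately obtain E A
      where E [measurable]: "E \<in> sets lebesgue" and A: "1 < A"
        and gE: "(\<integral>\<^sup>+x\<in>E. ennreal c * indicator U x \<partial>lebesgue) = ennreal A"
      using nn_integral_truncation[of "\<lambda>x. ennreal c * indicator U x"] by blast
    define h where "h x = ennreal (1 / A) * (ennreal c * indicator U x * indicator E x)" for x
    have [measurable]: "h \<in> borel_measurable lebesgue"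
      unfolding h_def by measurable
    have int_h: "(\<integral>\<^sup>+x. h x \<partial>lebesgue) = 1"
      unfolding h_def using scaled[OF A gE] by (subst nn_integral_cmult) measurable
    have q1: "?q x = 1" if "x \<in> U" for x
      using that by (simp add: U_def conj_exponent_def)
    have "var_ball ?q h"
      unfolding var_ball_def
    proof
      have "(\<integral>\<^sup>+x\<in>{x. ?q x \<noteq> \<infinity>}. enn_powr (h x) (enn2real (?q x)) \<partial>lebesgue)
          \<le> (\<integral>\<^sup>+x. h x \<partial>lebesgue)"
      proof (intro nn_integral_mono)
        fix x
        show "enn_powr (h x) (enn2real (?q x)) * indicator {x. ?q x \<noteq> \<infinity>} x \<le> h x"
        proof (cases "x \<in> U")
          case False
          have "0 < enn2real (?q x)" if "?q x \<noteq> \<infinity>"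
            using enn2real_exponent_ge_1[OF conj_exponent_in_var_exponents[OF p] that] by simp
          with False show ?thesis
            by (simp add: h_def enn_powr_zero_base split: split_indicator)
        qed (simp add: q1)
      qed
      then show "(\<integral>\<^sup>+x\<in>{x. ?q x \<noteq> \<infinity>}. enn_powr (h x) (enn2real (?q x)) \<partial>lebesgue) \<le> 1"
        using int_h by simp
      show "AE x in lebesgue. ?q x = \<infinity> \<longrightarrow> h x \<le> 1"
      proof (intro AE_I2 impI)
        fix x assume "?q x = \<infinity>"
        then have "x \<notin> U" using q1[of x] by auto
        then show "h x \<le> 1" by (simp add: h_def)
      qed
    qed
    moreover have "(\<integral>\<^sup>+x. h x \<partial>lebesgue) \<le> (\<integral>\<^sup>+x. f x * h x \<partial>lebesgue)"
    proof (intro nn_integral_mono)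
      fix x
      show "h x \<le> f x * h x"
      proof (cases "x \<in> U")
        case True
        then have "1 \<le> f x" by (auto simp: U_def)
        from mult_right_mono[OF this, of "h x"] show ?thesis by simp
      qed (simp add: h_def)
    qed
    ultimately show thesis using int_h by (intro that[of h]) auto
  qed
qed

section \<open>The maximal operator\<close>

text \<open>
  The maximal operator on \<open>[0,\<infinity>]\<close>-valued functions. Iterating \<^const>\<open>maximal\<close> itself would require
  turning \<open>Mf\<close> back into a real-valued function at every step.
\<close>

definition HL_max :: "('a::euclidean_space \<Rightarrow> ennreal) \<Rightarrow> 'a \<Rightarrow> ennreal" where
  "HL_max h x = (SUP B \<in> {B \<in> balls. x \<in> B}. avg B h)"

lemma maximal_eq_HL_max: "maximal f = HL_max (\<lambda>y. ennreal \<bar>f y\<bar>)"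
  by (simp add: maximal_def HL_max_def fun_eq_iff)

lemma avg_le_HL_max: "B \<in> balls \<Longrightarrow> x \<in> B \<Longrightarrow> avg B h \<le> HL_max h x"
  by (auto simp: HL_max_def intro: SUP_upper)

lemma balls_measurable: "B \<in> balls \<Longrightarrow> B \<in> sets lebesgue"
  using lmeasurable_ball by (auto simp: balls_def intro: fmeasurableD)

lemma emeasure_balls:
  assumes "B \<in> balls"
  shows "emeasure lebesgue B \<noteq> 0" "emeasure lebesgue B \<noteq> \<infinity>"
proof -
  obtain c r where B: "B = ball c r" "0 < r" using assms by (auto simp: balls_def)
  then show "emeasure lebesgue B \<noteq> \<infinity>"
    using fmeasurableD2[OF lmeasurable_ball, of c r] by simp
  have "\<not> negligible (ball c r)"
    using B(2) open_not_negligible[of "ball c r"] by simp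
  then show "emeasure lebesgue B \<noteq> 0"
    using B lmeasurable_ball[of c r] by (auto simp: negligible_iff_null_sets null_sets_def)
qed

text \<open>
  \<open>Mh\<close> is lower semicontinuous for every \<open>h\<close>, because \<open>{Mh > a}\<close> is a union of open balls.
\<close>

lemma HL_max_measurable [measurable]: "HL_max h \<in> borel_measurable lebesgue"
proof -
  have "HL_max h \<in> borel_measurable borel"
  proof (rule borel_measurableI_greater)
    fix a
    have "{x \<in> space borel. a < HL_max h x} = \<Union>{B \<in> balls. a < avg B h}"
      unfolding HL_max_def less_SUP_iff by auto
    moreover have "open (\<Union>{B \<in> balls. a < avg B h})"
      by (intro open_Union) (auto simp: balls_def)
    ultimately show "{x \<in> space borel. a < HL_max h x} \<in> sets borel" by simp
  qed
  then show ?thesis by (intro measurable_completion) simp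
qed

lemma avg_cong_AE: "AE x in lebesgue. g x = h x \<Longrightarrow> avg B g = avg B h"
  unfolding avg_def by (intro arg_cong2[where f="(/)"] nn_integral_cong_AE) auto

lemma avg_mono_AE:
  assumes "AE x in lebesgue. x \<in> B \<longrightarrow> g x \<le> h x"
  shows "avg B g \<le> avg B h"
  unfolding avg_def using assms
  by (intro divide_right_mono_ennreal nn_integral_mono_AE)
    (auto elim!: eventually_mono simp: indicator_def)

lemma avg_cmult:
  assumes "h \<in> borel_measurable lebesgue" "B \<in> balls"
  shows "avg B (\<lambda>x. c * h x) = c * avg B h"
proof -
  note [measurable] = assms(1) balls_measurable[OF assms(2)]
  have "(\<integral>\<^sup>+x\<in>B. c * h x \<partial>lebesgue) = c * (\<integral>\<^sup>+x\<in>B. h x \<partial>lebesgue)"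
    by (simp add: mult.assoc nn_integral_cmult)
  then show ?thesis by (simp add: avg_def divide_ennreal_def mult.assoc)
qed

lemma avg_suminf:
  assumes "\<And>k. f k \<in> borel_measurable lebesgue" "B \<in> balls"
  shows "avg B (\<lambda>x. \<Sum>k. f k x) = (\<Sum>k. avg B (f k))"
proof -
  note [measurable] = assms(1) balls_measurable[OF assms(2)]
  have "(\<integral>\<^sup>+x\<in>B. (\<Sum>k. f k x) \<partial>lebesgue) = (\<Sum>k. \<integral>\<^sup>+x\<in>B. f k x \<partial>lebesgue)"
    by (simp add: nn_integral_suminf flip: ennreal_suminf_multc)
  then show ?thesis by (simp add: avg_def)
qed

lemma HL_max_suminf_le:
  assumes "\<And>k. f k \<in> borel_measurable lebesgue"
  shows "HL_max (\<lambda>x. \<Sum>k. c k * f k x) x \<le> (\<Sum>k. c k * HL_max (f k) x)"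
  unfolding HL_max_def[of "\<lambda>x. \<Sum>k. c k * f k x"]
proof (rule SUP_least)
  fix B assume B: "B \<in> {B \<in> balls. x \<in> B}"
  with assms have "avg B (\<lambda>x. \<Sum>k. c k * f k x) = (\<Sum>k. c k * avg B (f k))"
    by (subst avg_suminf) (auto simp: avg_cmult)
  also have "\<dots> \<le> (\<Sum>k. c k * HL_max (f k) x)"
    using B by (intro suminf_le summableI mult_left_mono avg_le_HL_max) auto
  finally show "avg B (\<lambda>x. \<Sum>k. c k * f k x) \<le> (\<Sum>k. c k * HL_max (f k) x)" .
qed

text \<open>
  Boundedness passes from real-valued to \<open>[0,\<infinity>]\<close>-valued functions, because a function of finite
  norm is finite almost everywhere and averages do not see null sets.
\<close>

lemma maximal_bounded_imp_var_ball:
  assumes p: "p \<in> var_exponents" and u: "u \<in> pos_finite_weights" and M: "maximal_bounded p u"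
  obtains C :: real where "0 < C"
    "\<And>h. h \<in> borel_measurable lebesgue \<Longrightarrow> var_ball p (\<lambda>x. h x * u x) \<Longrightarrow>
        var_ball p (\<lambda>x. ennreal (1 / C) * HL_max h x * u x)"
proof -
  have u_meas [measurable]: "u \<in> borel_measurable lebesgue" and u_AE: "AE x in lebesgue. 0 < u x \<and> u x < \<infinity>"
    using u by (auto simp: pos_finite_weights_def weights_def)
  obtain C where C: "0 < C" and bound: "\<And>f. f \<in> weighted_Lp p u \<Longrightarrow>
      weighted_norm p u (maximal f) \<le> ennreal C * weighted_norm p u (\<lambda>x. ennreal \<bar>f x\<bar>)"
    using M unfolding maximal_bounded_def by blast
  have "var_ball p (\<lambda>x. ennreal (1 / (3 * C)) * HL_max h x * u x)"
    if [measurable]: "h \<in> borel_measurable lebesgue" and ball: "var_ball p (\<lambda>x. h x * u x)" for h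
  proof -
    have "AE x in lebesgue. h x * u x < \<infinity>"
      by (rule var_ball_finite_AE[OF p _ ball]) measurable
    then have fin: "AE x in lebesgue. ennreal \<bar>enn2real (h x)\<bar> = h x"
      using u_AE by eventually_elim (auto simp: ennreal_mult_less_top)
    define f where "f x = enn2real (h x)" for x
    have [measurable]: "f \<in> borel_measurable lebesgue" unfolding f_def by measurable
    have max_eq: "maximal f = HL_max h"
      unfolding maximal_eq_HL_max HL_max_def f_def using avg_cong_AE[OF fin] by simp
    have norm_le: "weighted_norm p u (\<lambda>x. ennreal \<bar>f x\<bar>) \<le> ennreal 2"
    proof -
      have "var_ball p (\<lambda>x. ennreal (1 / 1) * (ennreal \<bar>f x\<bar> * u x))"
        by (rule var_ball_mono[OF p _ ball]) (use fin in \<open>auto simp: f_def elim!: eventually_mono\<close>)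
      then show ?thesis
        unfolding weighted_norm_def using var_norm_le_of_var_ball[OF p, of _ 1] by simp
    qed
    then have "weighted_norm p u (\<lambda>x. ennreal \<bar>f x\<bar>) < \<infinity>"
      by (rule le_less_trans) simp
    then have "f \<in> weighted_Lp p u" by (simp add: weighted_Lp_def)
    from bound[OF this] have "weighted_norm p u (HL_max h) \<le> ennreal C * weighted_norm p u (\<lambda>x. ennreal \<bar>f x\<bar>)"
      by (simp only: max_eq)
    also have "\<dots> \<le> ennreal C * ennreal 2" by (intro mult_left_mono norm_le) simp
    also have "\<dots> < ennreal (3 * C)"
      using C by (simp add: ennreal_less_iff flip: ennreal_mult ennreal_numeral)
    finally show ?thesis
      using var_ball_of_var_norm_less[OF p] by (simp add: weighted_norm_def mult.assoc)
  qed
  with C that[of "3 * C"] show thesis by simp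
qed

section \<open>Rubio de Francia majorants\<close>

text \<open>
  The Rubio de Francia algorithm \<open>R h = \<Sum>\<^sub>k 4\<^sup>-\<^sup>k T\<^sup>k h\<close> with \<open>T = M / C\<close>, where \<open>C\<close> is chosen such
  that \<open>T\<close> preserves the unit ball. Applying \<open>M\<close> shifts the series by one index, whence
  \<open>M (R h) \<le> 4 C R h\<close>.
\<close>

lemma Rubio_de_Francia:
  assumes p: "p \<in> var_exponents" and u: "u \<in> pos_finite_weights" and M: "maximal_bounded p u"
    and h: "h \<in> borel_measurable lebesgue" "var_ball p (\<lambda>x. h x * u x)"
  obtains R and C :: real where "0 < C" "R \<in> borel_measurable lebesgue" "\<And>x. h x \<le> R x"
    "\<And>x. HL_max R x \<le> ennreal C * R x" "var_ball p (\<lambda>x. ennreal (1/4) * (R x * u x))"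
proof -
  have u_meas [measurable]: "u \<in> borel_measurable lebesgue"
    using u by (auto simp: pos_finite_weights_def weights_def)
  obtain C where C: "0 < C" and bound: "\<And>h. h \<in> borel_measurable lebesgue \<Longrightarrow>
      var_ball p (\<lambda>x. h x * u x) \<Longrightarrow> var_ball p (\<lambda>x. ennreal (1 / C) * HL_max h x * u x)"
    using maximal_bounded_imp_var_ball[OF p u M] by blast
  define T where "T g x = ennreal (1 / C) * HL_max g x" for g :: "'a \<Rightarrow> ennreal" and x
  define R where "R x = (\<Sum>k. ennreal ((1/4)^k) * (T ^^ k) h x)" for x
  have T_iter: "(T ^^ k) h \<in> borel_measurable lebesgue \<and> var_ball p (\<lambda>x. (T ^^ k) h x * u x)" for k
    using h bound by (induction k) (auto simp: T_def[abs_def])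
  then have [measurable]: "(T ^^ k) h \<in> borel_measurable lebesgue" for k by blast
  have R_meas: "R \<in> borel_measurable lebesgue" unfolding R_def by measurable
  have "h x \<le> R x" for x
    unfolding R_def using sum_le_suminf[OF summableI, of "{0}" "\<lambda>k. ennreal ((1/4)^k) * (T ^^ k) h x"]
    by simp
  moreover have "HL_max R x \<le> ennreal (4 * C) * R x" for x
  proof -
    have "HL_max R x \<le> (\<Sum>k. ennreal ((1/4)^k) * HL_max ((T ^^ k) h) x)"
      unfolding R_def by (rule HL_max_suminf_le) measurable
    also have "\<dots> = (\<Sum>k. ennreal (4 * C) * (ennreal ((1/4)^(k + 1)) * (T ^^ (k + 1)) h x))"
    proof (intro suminf_cong)
      fix k
      have "ennreal (4 * C) * (ennreal ((1/4)^(k + 1)) * ennreal (1 / C)) = ennreal ((1/4)^k)"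
        using C by (simp add: field_simps flip: ennreal_mult)
      then show "ennreal ((1/4)^k) * HL_max ((T ^^ k) h) x
          = ennreal (4 * C) * (ennreal ((1/4)^(k + 1)) * (T ^^ (k + 1)) h x)"
        by (simp add: T_def mult.assoc[symmetric])
    qed
    also have "\<dots> = ennreal (4 * C) * (\<Sum>k. ennreal ((1/4)^(k + 1)) * (T ^^ (k + 1)) h x)"
      by (rule ennreal_suminf_cmult)
    also have "\<dots> \<le> ennreal (4 * C) * R x"
      unfolding R_def
      using suminf_offset[OF summableI, of "\<lambda>k. ennreal ((1/4)^k) * (T ^^ k) h x" 1]
      by (intro mult_left_mono) (auto simp: add_increasing2)
    finally show ?thesis .
  qed
  moreover have "var_ball p (\<lambda>x. ennreal (1/4) * (R x * u x))"
  proof -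
    have "var_ball p (\<lambda>x. ennreal (1/4) * (\<Sum>k. ennreal ((1/4)^k) * ((T ^^ k) h x * u x)))"
      using T_iter by (intro var_ball_suminf p) auto
    then show ?thesis by (simp add: R_def mult.assoc[symmetric])
  qed
  ultimately show thesis using C R_meas that[of "4 * C" R] by simp
qed

text \<open>
  One majorant for countably many functions: the algorithm is applied to \<open>\<Sum>\<^sub>k 4\<^sup>-\<^sup>k h\<^sub>k\<close>. The price is
  a constant that grows geometrically with \<open>k\<close>.
\<close>

lemma Rubio_de_Francia_sequence:
  assumes p: "p \<in> var_exponents" and u: "u \<in> pos_finite_weights" and M: "maximal_bounded p u"
    and h: "\<And>k. h k \<in> borel_measurable lebesgue" "\<And>k. var_ball p (\<lambda>x. h k x * u x)"
  obtains R and C :: real where "0 < C" "R \<in> borel_measurable lebesgue"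
    "\<And>k x. h k x \<le> ennreal (4^(k + 1)) * R x"
    "\<And>x. HL_max R x \<le> ennreal C * R x" "var_ball p (\<lambda>x. ennreal (1/4) * (R x * u x))"
proof -
  note [measurable] = h(1)
  have [measurable]: "u \<in> borel_measurable lebesgue"
    using u by (auto simp: pos_finite_weights_def weights_def)
  define H where "H x = ennreal (1/4) * (\<Sum>k. ennreal ((1/4)^k) * h k x)" for x
  have "H \<in> borel_measurable lebesgue" unfolding H_def by measurable
  moreover have "var_ball p (\<lambda>x. H x * u x)"
  proof -
    have "var_ball p (\<lambda>x. ennreal (1/4) * (\<Sum>k. ennreal ((1/4)^k) * (h k x * u x)))"
      using h by (intro var_ball_suminf p) auto
    then show ?thesis by (simp add: H_def mult.assoc[symmetric])
  qed
  ultimately obtain R C where R: "0 < C" "R \<in> borel_measurable lebesgue" "\<And>x. H x \<le> R x"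
    "\<And>x. HL_max R x \<le> ennreal C * R x" "var_ball p (\<lambda>x. ennreal (1/4) * (R x * u x))"
    by (rule Rubio_de_Francia[OF p u M]) blast
  have "h k x \<le> ennreal (4^(k + 1)) * R x" for k x
  proof -
    have "ennreal (4^(k + 1)) * (ennreal (1/4) * ennreal ((1/4)^k)) = 1"
      by (simp add: power_divide flip: ennreal_mult)
    then have "h k x = ennreal (4^(k + 1)) * (ennreal (1/4) * (ennreal ((1/4)^k) * h k x))"
      by (simp add: mult.assoc[symmetric])
    also have "\<dots> \<le> ennreal (4^(k + 1)) * H x"
      unfolding H_def
      using sum_le_suminf[OF summableI, of "{k}" "\<lambda>k. ennreal ((1/4)^k) * h k x"]
      by (intro mult_left_mono) auto
    also have "\<dots> \<le> ennreal (4^(k + 1)) * R x" by (intro mult_left_mono R) auto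
    finally show ?thesis .
  qed
  with R that show thesis by blast
qed

section \<open>Muckenhoupt weights from the maximal operator\<close>

lemma A_1_of_HL_max_le:
  assumes v: "v \<in> borel_measurable lebesgue" and max: "\<And>x. HL_max v x \<le> ennreal C * v x"
    and C: "0 < C"
  shows "v \<in> A_1"
proof -
  have "avg B v / essinf_on B v \<le> ennreal C" if B: "B \<in> balls" for B
  proof -
    have "ennreal (1 / C) * avg B v \<le> v x" if "x \<in> B" for x
    proof -
      have "ennreal (1 / C) * avg B v \<le> ennreal (1 / C) * (ennreal C * v x)"
        by (intro mult_left_mono order_trans[OF avg_le_HL_max[OF B that] max]) simp
      then show ?thesis using C by (simp add: mult.assoc[symmetric] flip: ennreal_mult)
    qed
    then have le: "ennreal (1 / C) * avg B v \<le> essinf_on B v"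
      unfolding essinf_on_def by (intro Sup_upper) simp
    have "avg B v = ennreal C * (ennreal (1 / C) * avg B v)"
      using C by (simp add: mult.assoc[symmetric] flip: ennreal_mult)
    also have "\<dots> \<le> ennreal C * essinf_on B v" using le by (intro mult_left_mono) auto
    finally have *: "avg B v \<le> ennreal C * essinf_on B v" .
    \<comment> \<open>If the essential infimum is 0, so is the average; and a quotient with denominator \<open>\<infinity>\<close> is 0.\<close>
    show ?thesis
    proof (cases "essinf_on B v = 0 \<or> essinf_on B v = \<infinity>")
      case True
      with * have "avg B v = 0 \<or> essinf_on B v = \<infinity>" by auto
      then show ?thesis by (auto simp: divide_ennreal_def)
    next
      case False
      have "avg B v / essinf_on B v \<le> ennreal C * essinf_on B v / essinf_on B v"
        by (intro divide_right_mono_ennreal *)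
      also have "\<dots> = ennreal C"
        using False by (simp add: ennreal_mult_divide_eq)
      finally show ?thesis .
    qed
  qed
  then have "(SUP B \<in> balls. avg B v / essinf_on B v) \<le> ennreal C" by (rule SUP_least)
  also have "\<dots> < \<infinity>" by simp
  finally show ?thesis using v by (simp add: A_1_def weights_def)
qed

text \<open>
  If \<open>Mh\<close> vanishes at one point, then \<open>h\<close> vanishes almost everywhere on every ball around it.
\<close>

lemma HL_max_pos:
  assumes [measurable]: "h \<in> borel_measurable lebesgue" and nz: "\<not> (AE x in lebesgue. h x = 0)"
  shows "0 < HL_max h x"
proof (rule ccontr)
  assume "\<not> 0 < HL_max h x"
  then have 0: "HL_max h x = 0" by simp
  have "AE y in lebesgue. y \<in> ball x r \<longrightarrow> h y = 0" if r: "0 < r" for r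
  proof -
    let ?B = "ball x r"
    have B: "?B \<in> balls" unfolding balls_def using r by blast
    note [measurable] = balls_measurable[OF B]
    have "avg ?B h \<le> 0" using avg_le_HL_max[OF B, of x h] 0 r by simp
    then have "(\<integral>\<^sup>+y\<in>?B. h y \<partial>lebesgue) = 0"
      using emeasure_balls[OF B] by (simp add: avg_def divide_ennreal_def ennreal_inverse_eq_0_iff)
    then have "AE y in lebesgue. h y * indicator ?B y = 0"
      by (subst (asm) nn_integral_0_iff_AE) auto
    then show ?thesis by eventually_elim (auto simp: indicator_def)
  qed
  then have "AE y in lebesgue. \<forall>n. y \<in> ball x (real (Suc n)) \<longrightarrow> h y = 0"
    by (subst AE_all_countable) simp
  then have "AE y in lebesgue. h y = 0"
  proof eventually_elim
    case (elim y)
    obtain n where "dist x y < real n" using reals_Archimedean2 by blast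
    then have "y \<in> ball x (real (Suc n))" by simp
    with elim show ?case by blast
  qed
  with nz show False ..
qed

lemma balls_not_AE_disjoint:
  assumes "B \<in> balls" shows "\<not> (AE x in lebesgue. x \<notin> B)"
proof
  assume "AE x in lebesgue. x \<notin> B"
  then have "emeasure lebesgue B = 0"
    using balls_measurable[OF assms] by (subst (asm) AE_iff_measurable[of B]) auto
  with emeasure_balls[OF assms] show False by simp
qed

text \<open>
  Degenerate averages are excluded here, so that the two averages in the \<open>A\<^sub>p\<close> condition can be
  computed with positive real numbers.
\<close>

lemma avg_pos_finite:
  assumes [measurable]: "v \<in> borel_measurable lebesgue"
    and v: "AE x in lebesgue. 0 < v x \<and> v x < \<infinity>"
    and max: "\<And>x. HL_max v x \<le> ennreal C * v x" and C: "0 < C" and B: "B \<in> balls"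
  obtains a where "0 < a" "avg B v = ennreal a" "\<And>x. x \<in> B \<Longrightarrow> ennreal (a / C) \<le> v x"
proof -
  note [measurable] = balls_measurable[OF B]
  have le: "ennreal (1 / C) * avg B v \<le> v x" if "x \<in> B" for x
  proof -
    have "ennreal (1 / C) * avg B v \<le> ennreal (1 / C) * (ennreal C * v x)"
      by (intro mult_left_mono order_trans[OF avg_le_HL_max[OF B that] max]) simp
    then show ?thesis using C by (simp add: mult.assoc[symmetric] flip: ennreal_mult)
  qed
  have "avg B v \<noteq> \<infinity>"
  proof
    assume "avg B v = \<infinity>"
    then have top: "v x = \<infinity>" if "x \<in> B" for x
      using le[OF that] C by (auto simp: ennreal_mult_top top_unique)
    from v have "AE x in lebesgue. x \<notin> B" by eventually_elim (use top in force)
    with balls_not_AE_disjoint[OF B] show False ..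
  qed
  moreover have "avg B v \<noteq> 0"
  proof
    assume "avg B v = 0"
    then have "(\<integral>\<^sup>+x\<in>B. v x \<partial>lebesgue) = 0"
      using emeasure_balls[OF B] by (simp add: avg_def divide_ennreal_def ennreal_inverse_eq_0_iff)
    then have "AE x in lebesgue. v x * indicator B x = 0"
      by (subst (asm) nn_integral_0_iff_AE) auto
    then have "AE x in lebesgue. x \<notin> B" using v by eventually_elim (auto simp: indicator_def)
    with balls_not_AE_disjoint[OF B] show False ..
  qed
  ultimately obtain a where a: "avg B v = ennreal a" "0 < a"
    by (cases "avg B v") (auto simp: less_le)
  show thesis
  proof (rule that[OF a(2,1)])
    fix x assume "x \<in> B"
    from le[OF this] a C show "ennreal (a / C) \<le> v x" by (simp flip: ennreal_mult)
  qed
qed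

text \<open>
  The easy half of the Jones factorisation. On a ball, \<open>v\<^sub>i\<close> is bounded below by a multiple of its
  average, so negative powers of \<open>v\<^sub>i\<close> are bounded above by powers of the average. Hence
  \<open>w = v\<^sub>1\<^sup>1\<^sup>-\<^sup>P v\<^sub>2\<close> is controlled by \<open>v\<^sub>2\<close>, and its dual weight \<open>v\<^sub>1 v\<^sub>2\<^sup>-\<^sup>1\<^sup>/\<^sup>(\<^sup>P\<^sup>-\<^sup>1\<^sup>)\<close> by \<open>v\<^sub>1\<close>; in the
  product the averages cancel.
\<close>

lemma A_p_of_HL_max_le:
  fixes v\<^sub>1 v\<^sub>2 :: "'a::euclidean_space \<Rightarrow> ennreal"
  assumes [measurable]: "v\<^sub>1 \<in> borel_measurable lebesgue" "v\<^sub>2 \<in> borel_measurable lebesgue"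
    and v\<^sub>1: "AE x in lebesgue. 0 < v\<^sub>1 x \<and> v\<^sub>1 x < \<infinity>"
    and v\<^sub>2: "AE x in lebesgue. 0 < v\<^sub>2 x \<and> v\<^sub>2 x < \<infinity>"
    and max\<^sub>1: "\<And>x. HL_max v\<^sub>1 x \<le> ennreal C\<^sub>1 * v\<^sub>1 x" and C\<^sub>1: "0 < C\<^sub>1"
    and max\<^sub>2: "\<And>x. HL_max v\<^sub>2 x \<le> ennreal C\<^sub>2 * v\<^sub>2 x" and C\<^sub>2: "0 < C\<^sub>2"
    and P: "1 < P"
  shows "(\<lambda>x. enn_powr (v\<^sub>1 x) (1 - P) * v\<^sub>2 x) \<in> A_p P"
proof -
  define w where "w x = enn_powr (v\<^sub>1 x) (1 - P) * v\<^sub>2 x" for x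
  define e where "e = 1 - P / (P - 1)"
  have e: "e < 0" "(1 - P) * e = 1" "e * (P - 1) = - 1"
    using P by (simp_all add: e_def field_simps)
  have [measurable]: "w \<in> borel_measurable lebesgue" unfolding w_def by measurable
  have "avg B w * enn_powr (avg B (\<lambda>x. enn_powr (w x) e)) (P - 1) \<le> ennreal (C\<^sub>1 powr (P - 1) * C\<^sub>2)"
    if B: "B \<in> balls" for B
  proof -
    obtain a where a: "0 < a" "avg B v\<^sub>1 = ennreal a" "\<And>x. x \<in> B \<Longrightarrow> ennreal (a / C\<^sub>1) \<le> v\<^sub>1 x"
      using avg_pos_finite[OF _ v\<^sub>1 max\<^sub>1 C\<^sub>1 B] by auto
    obtain b where b: "0 < b" "avg B v\<^sub>2 = ennreal b" "\<And>x. x \<in> B \<Longrightarrow> ennreal (b / C\<^sub>2) \<le> v\<^sub>2 x"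
      using avg_pos_finite[OF _ v\<^sub>2 max\<^sub>2 C\<^sub>2 B] by auto
    have neg_power: "enn_powr t s \<le> ennreal (c powr s)"
      if "0 < c" "ennreal c \<le> t" "t < \<infinity>" "s \<le> 0" for c s t
    proof -
      obtain t' where t: "t = ennreal t'" "0 \<le> t'" using \<open>t < \<infinity>\<close> by (cases t) auto
      with that have "c \<le> t'" by (simp add: ennreal_le_iff)
      with that t show ?thesis by (simp add: enn_powr_ennreal powr_mono2')
    qed
    have "AE x in lebesgue. x \<in> B \<longrightarrow> w x \<le> ennreal ((a / C\<^sub>1) powr (1 - P)) * v\<^sub>2 x"
      using v\<^sub>1
      by eventually_elim (use P a C\<^sub>1 in \<open>auto simp: w_def intro!: mult_right_mono neg_power\<close>)
    then have "avg B w \<le> avg B (\<lambda>x. ennreal ((a / C\<^sub>1) powr (1 - P)) * v\<^sub>2 x)"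
      by (rule avg_mono_AE)
    also have "\<dots> = ennreal ((a / C\<^sub>1) powr (1 - P)) * ennreal b"
      by (subst avg_cmult) (use B b in auto)
    finally have 1: "avg B w \<le> ennreal ((a / C\<^sub>1) powr (1 - P) * b)"
      using b by (simp add: ennreal_mult)
    have "AE x in lebesgue. x \<in> B \<longrightarrow> enn_powr (w x) e \<le> ennreal ((b / C\<^sub>2) powr e) * v\<^sub>1 x"
      using v\<^sub>1 v\<^sub>2
    proof (eventually_elim, intro impI)
      fix x assume x: "0 < v\<^sub>1 x \<and> v\<^sub>1 x < \<infinity>" "0 < v\<^sub>2 x \<and> v\<^sub>2 x < \<infinity>" "x \<in> B"
      then obtain r s where rs: "v\<^sub>1 x = ennreal r" "0 < r" "v\<^sub>2 x = ennreal s" "0 < s"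
        by (cases "v\<^sub>1 x"; cases "v\<^sub>2 x") auto
      have "w x = ennreal (r powr (1 - P) * s)"
        using rs by (simp add: w_def enn_powr_ennreal ennreal_mult)
      then have "enn_powr (w x) e = ennreal ((r powr (1 - P) * s) powr e)"
        using rs by (simp add: enn_powr_ennreal)
      also have "(r powr (1 - P) * s) powr e = s powr e * r"
        using rs e(2) by (simp add: powr_mult powr_powr)
      also have "ennreal (s powr e * r) = enn_powr (v\<^sub>2 x) e * v\<^sub>1 x"
        using rs by (simp add: enn_powr_ennreal ennreal_mult)
      also have "\<dots> \<le> ennreal ((b / C\<^sub>2) powr e) * v\<^sub>1 x"
        using x b C\<^sub>2 e by (intro mult_right_mono neg_power) auto
      finally show "enn_powr (w x) e \<le> ennreal ((b / C\<^sub>2) powr e) * v\<^sub>1 x" .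
    qed
    then have "avg B (\<lambda>x. enn_powr (w x) e) \<le> avg B (\<lambda>x. ennreal ((b / C\<^sub>2) powr e) * v\<^sub>1 x)"
      by (rule avg_mono_AE)
    also have "\<dots> = ennreal ((b / C\<^sub>2) powr e * a)"
      by (subst avg_cmult) (use B a in \<open>auto simp: ennreal_mult\<close>)
    finally have "enn_powr (avg B (\<lambda>x. enn_powr (w x) e)) (P - 1) \<le> enn_powr (ennreal ((b / C\<^sub>2) powr e * a)) (P - 1)"
      using P by (intro enn_powr_mono) auto
    also have "\<dots> = ennreal (((b / C\<^sub>2) powr e * a) powr (P - 1))"
      using a b C\<^sub>2 by (simp add: enn_powr_ennreal)
    also have "((b / C\<^sub>2) powr e * a) powr (P - 1) = C\<^sub>2 / b * a powr (P - 1)"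
      using a b C\<^sub>2 e(3) by (simp add: powr_mult powr_powr powr_minus_divide)
    finally have 2: "enn_powr (avg B (\<lambda>x. enn_powr (w x) e)) (P - 1) \<le> ennreal (C\<^sub>2 / b * a powr (P - 1))" .
    have "a powr (1 - P) * a powr (P - 1) = 1" "C\<^sub>1 powr (1 - P) = 1 / C\<^sub>1 powr (P - 1)"
      using a powr_minus_divide[of C\<^sub>1 "P - 1"] by (simp_all flip: powr_add)
    then have eq: "((a / C\<^sub>1) powr (1 - P) * b) * (C\<^sub>2 / b * a powr (P - 1)) = C\<^sub>1 powr (P - 1) * C\<^sub>2"
      using a b C\<^sub>1 by (simp add: powr_divide mult_ac)
    have "avg B w * enn_powr (avg B (\<lambda>x. enn_powr (w x) e)) (P - 1)
        \<le> ennreal ((a / C\<^sub>1) powr (1 - P) * b) * ennreal (C\<^sub>2 / b * a powr (P - 1))"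
      by (rule mult_mono[OF 1 2]) auto
    also have "\<dots> = ennreal (C\<^sub>1 powr (P - 1) * C\<^sub>2)"
      using a b C\<^sub>1 C\<^sub>2 by (subst ennreal_mult[symmetric]) (simp_all only: eq, simp_all)
    finally show ?thesis .
  qed
  then have "(SUP B \<in> balls. avg B w * enn_powr (avg B (\<lambda>x. enn_powr (w x) e)) (P - 1))
      \<le> ennreal (C\<^sub>1 powr (P - 1) * C\<^sub>2)"
    by (rule SUP_least)
  also have "\<dots> < \<infinity>" by simp
  finally have "w \<in> A_p P" by (simp add: A_p_def weights_def e_def)
  then show ?thesis by (simp add: w_def[abs_def])
qed

section \<open>Normalised counterexamples\<close>

lemma inverse_pos_finite_weights:
  assumes "w \<in> pos_finite_weights" shows "(\<lambda>x. inverse (w x)) \<in> pos_finite_weights"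
proof -
  have [measurable]: "w \<in> borel_measurable lebesgue" and AE: "AE x in lebesgue. 0 < w x \<and> w x < \<infinity>"
    using assms by (auto simp: pos_finite_weights_def weights_def)
  have "AE x in lebesgue. 0 < inverse (w x) \<and> inverse (w x) < \<infinity>"
    using AE by eventually_elim (auto simp: less_top[symmetric] ennreal_inverse_positive)
  then show ?thesis by (auto simp: pos_finite_weights_def weights_def)
qed

lemma pos_finite_weights_mult_inverse:
  assumes "w \<in> pos_finite_weights"
  shows "AE x in lebesgue. w x * inverse (w x) = 1"
proof -
  have "AE x in lebesgue. 0 < w x \<and> w x < \<infinity>"
    using assms by (auto simp: pos_finite_weights_def)
  then show ?thesis
  proof eventually_elim
    case (elim x)
    then show ?case using ennreal_divide_self[of "w x"] by (auto simp: divide_ennreal_def)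
  qed
qed

text \<open>
  Hoelder's inequality for \<open>L\<^sup>p(w)\<close> and \<open>L\<^sup>p\<^sup>'(w\<^sup>-\<^sup>1)\<close>; the factor 1/4 is the one that
  the majorants of the Rubio de Francia algorithm carry.
\<close>

lemma nn_integral_mult_le_weighted:
  assumes p: "p \<in> var_exponents" and w: "w \<in> pos_finite_weights"
    and [measurable]: "f \<in> borel_measurable lebesgue" "g \<in> borel_measurable lebesgue"
    and f: "var_ball p (\<lambda>x. f x * w x)"
    and g: "var_ball (conj_exponent p) (\<lambda>x. ennreal (1/4) * (g x * inverse (w x)))"
  shows "(\<integral>\<^sup>+x. f x * g x \<partial>lebesgue) \<le> 8"
proof -
  have [measurable]: "w \<in> borel_measurable lebesgue"
    using w by (auto simp: pos_finite_weights_def weights_def)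
  have "AE x in lebesgue. f x * g x = ennreal 4 * ((f x * w x) * (ennreal (1/4) * (g x * inverse (w x))))"
    using pos_finite_weights_mult_inverse[OF w]
  proof eventually_elim
    case (elim x)
    have "ennreal 4 * ennreal (1/4) = 1" by (subst ennreal_mult[symmetric]) simp_all
    moreover have "ennreal 4 * ((f x * w x) * (ennreal (1/4) * (g x * inverse (w x))))
        = (ennreal 4 * ennreal (1/4)) * (w x * inverse (w x)) * (f x * g x)"
      by (simp only: ac_simps)
    ultimately show ?case using elim by simp
  qed
  then have "(\<integral>\<^sup>+x. f x * g x \<partial>lebesgue)
      = (\<integral>\<^sup>+x. ennreal 4 * ((f x * w x) * (ennreal (1/4) * (g x * inverse (w x)))) \<partial>lebesgue)"
    by (rule nn_integral_cong_AE)
  also have "\<dots> = ennreal 4 * (\<integral>\<^sup>+x. (f x * w x) * (ennreal (1/4) * (g x * inverse (w x))) \<partial>lebesgue)"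
    by (rule nn_integral_cmult) measurable
  also have "\<dots> \<le> ennreal 4 * 2"
    by (intro mult_left_mono nn_integral_mult_le_of_var_ball[OF p _ _ f g]) measurable
  finally show ?thesis by simp
qed

text \<open>
  A pair that violates the inequality with constant \<open>N\<close>, rescaled such that \<open>\<alpha> f w\<close> has norm 1/2.
  Then even \<open>N \<alpha> g w\<close> lies in the unit ball, and by duality some \<open>h\<close> in the dual unit ball pairs
  with \<open>\<alpha> f\<close> to at least 1/8. Stating the smallness of \<open>g\<close> in this way also covers \<open>g = 0\<close>.
\<close>

lemma normalized_counterexample:
  assumes p: "p \<in> var_exponents" and w: "w \<in> pos_finite_weights"
    and [measurable]: "f \<in> borel_measurable lebesgue" "g \<in> borel_measurable lebesgue"
    and N: "0 < N" and fin: "weighted_norm p w f < \<infinity>"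
    and less: "ennreal N * weighted_norm p w g < weighted_norm p w f"
  obtains \<alpha> h where "0 < \<alpha>" "h \<in> borel_measurable lebesgue"
    "var_ball p (\<lambda>x. ennreal \<alpha> * f x * w x)"
    "var_ball p (\<lambda>x. ennreal (N * \<alpha>) * g x * w x)"
    "var_ball (conj_exponent p) (\<lambda>x. h x * inverse (w x))"
    "ennreal (1/8) \<le> (\<integral>\<^sup>+x. ennreal \<alpha> * f x * h x \<partial>lebesgue)"
proof -
  have w_meas [measurable]: "w \<in> borel_measurable lebesgue"
    using w by (auto simp: pos_finite_weights_def weights_def)
  have "0 < weighted_norm p w f" using less by (rule le_less_trans[OF zero_le])
  with fin obtain a where a: "weighted_norm p w f = ennreal a" "0 < a"
    by (cases "weighted_norm p w f") auto
  obtain b where b: "weighted_norm p w g = ennreal b" "0 \<le> b"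
    using less N a by (cases "weighted_norm p w g") (auto simp: ennreal_mult_top)
  have Nb: "N * b < a"
    using less N a b by (simp add: ennreal_less_iff flip: ennreal_mult)
  define \<alpha> where "\<alpha> = 1 / (2 * a)"
  have ball_f: "var_ball p (\<lambda>x. ennreal \<alpha> * f x * w x)"
    using var_ball_of_var_norm_less[OF p, of "\<lambda>x. f x * w x" "2 * a"] a
    by (simp add: weighted_norm_def \<alpha>_def mult.assoc ennreal_less_iff)
  have "var_ball p (\<lambda>x. ennreal (1 / (a / N)) * (g x * w x))"
    using b Nb N by (intro var_ball_of_var_norm_less[OF p])
      (simp add: weighted_norm_def ennreal_less_iff field_simps)
  then have ball_g: "var_ball p (\<lambda>x. ennreal (N * \<alpha>) * g x * w x)"
  proof (rule var_ball_mono[OF p, rotated])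
    have "ennreal (N * \<alpha>) \<le> ennreal (1 / (a / N))"
      using a N by (intro ennreal_leI) (simp add: \<alpha>_def field_simps)
    then show "AE x in lebesgue. ennreal (N * \<alpha>) * g x * w x \<le> ennreal (1 / (a / N)) * (g x * w x)"
      unfolding mult.assoc by (intro AE_I2 mult_right_mono zero_le)
  qed
  \<comment> \<open>If \<open>4 f w / a\<close> were in the unit ball, the norm of \<open>f w\<close> would be at most \<open>a / 2\<close>.\<close>
  let ?F = "\<lambda>x. ennreal (1 / (a / 4)) * (f x * w x)"
  have "\<not> var_ball p ?F"
  proof
    assume "var_ball p ?F"
    then have "var_norm p (\<lambda>x. f x * w x) \<le> ennreal (2 * (a / 4))"
      using a by (intro var_norm_le_of_var_ball[OF p]) auto
    with a show False by (simp add: weighted_norm_def ennreal_le_iff)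
  qed
  moreover have "AE x in lebesgue. ?F x < \<infinity>"
  proof -
    have "AE x in lebesgue. ennreal \<alpha> * f x * w x < \<infinity>"
      by (rule var_ball_finite_AE[OF p _ ball_f]) measurable
    then show ?thesis
      by eventually_elim (use a in \<open>auto simp: \<alpha>_def mult.assoc ennreal_mult_less_top\<close>)
  qed
  moreover have "?F \<in> borel_measurable lebesgue" by measurable
  ultimately obtain h' where [measurable]: "h' \<in> borel_measurable lebesgue"
    and h': "var_ball (conj_exponent p) h'" "1 \<le> (\<integral>\<^sup>+x. ?F x * h' x \<partial>lebesgue)"
    using var_ball_dual[OF p, of ?F] by blast
  define h where "h x = h' x * w x" for x
  have [measurable]: "h \<in> borel_measurable lebesgue" unfolding h_def by measurable
  have "var_ball (conj_exponent p) (\<lambda>x. h x * inverse (w x))"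
  proof (rule var_ball_mono[OF conj_exponent_in_var_exponents[OF p] _ h'(1)])
    show "AE x in lebesgue. h x * inverse (w x) \<le> h' x"
      using pos_finite_weights_mult_inverse[OF w]
      by eventually_elim (simp add: h_def mult.assoc)
  qed
  moreover have "ennreal (1/8) \<le> (\<integral>\<^sup>+x. ennreal \<alpha> * f x * h x \<partial>lebesgue)"
  proof -
    have "ennreal (1/8) * 1 \<le> ennreal (1/8) * (\<integral>\<^sup>+x. ?F x * h' x \<partial>lebesgue)"
      by (intro mult_left_mono h') auto
    also have "\<dots> = (\<integral>\<^sup>+x. ennreal (1/8) * (?F x * h' x) \<partial>lebesgue)"
      by (rule nn_integral_cmult[symmetric]) measurable
    also have "\<dots> = (\<integral>\<^sup>+x. ennreal \<alpha> * f x * h x \<partial>lebesgue)"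
    proof (rule nn_integral_cong)
      fix x
      have "ennreal (1/8) * ennreal (1 / (a / 4)) = ennreal \<alpha>"
        using a by (subst ennreal_mult[symmetric]) (auto simp: \<alpha>_def)
      moreover have "ennreal (1/8) * (?F x * h' x)
          = (ennreal (1/8) * ennreal (1 / (a / 4))) * f x * (h' x * w x)"
        by (simp only: ac_simps)
      ultimately show "ennreal (1/8) * (?F x * h' x) = ennreal \<alpha> * f x * h x"
        by (simp only: h_def)
    qed
    finally show ?thesis by simp
  qed
  ultimately show thesis
    using a ball_f ball_g by (intro that[of \<alpha> h]) (auto simp: \<alpha>_def)
qed

lemma counterexample_sequence:
  fixes N :: "nat \<Rightarrow> real"
  assumes F: "\<forall>(f, g) \<in> F. f \<in> borel_measurable lebesgue \<and> g \<in> borel_measurable lebesgue"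
    and p: "p \<in> var_exponents" and w: "w \<in> pos_finite_weights"
    and not_ineq: "\<not> family_ineq F (weighted_norm p w)" and N: "\<And>k. 0 < N k"
  obtains f g h \<alpha> where "\<And>k. (f k, g k) \<in> F" "\<And>k. 0 < \<alpha> k"
    "\<And>k. f k \<in> borel_measurable lebesgue" "\<And>k. g k \<in> borel_measurable lebesgue"
    "\<And>k. h k \<in> borel_measurable lebesgue"
    "\<And>k. var_ball p (\<lambda>x. ennreal (\<alpha> k) * f k x * w x)"
    "\<And>k. var_ball p (\<lambda>x. ennreal (N k * \<alpha> k) * g k x * w x)"
    "\<And>k. var_ball (conj_exponent p) (\<lambda>x. h k x * inverse (w x))"
    "\<And>k. ennreal (1/8) \<le> (\<integral>\<^sup>+x. ennreal (\<alpha> k) * f k x * h k x \<partial>lebesgue)"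
proof -
  define Q where "Q k f g h a \<longleftrightarrow> (f, g) \<in> F \<and> 0 < a \<and>
      f \<in> borel_measurable lebesgue \<and> g \<in> borel_measurable lebesgue \<and> h \<in> borel_measurable lebesgue \<and>
      var_ball p (\<lambda>x. ennreal a * f x * w x) \<and> var_ball p (\<lambda>x. ennreal (N k * a) * g x * w x) \<and>
      var_ball (conj_exponent p) (\<lambda>x. h x * inverse (w x)) \<and>
      ennreal (1/8) \<le> (\<integral>\<^sup>+x. ennreal a * f x * h x \<partial>lebesgue)" for k f g h a
  have "\<exists>f g h a. Q k f g h a" for k
  proof -
    obtain f g where fg: "(f, g) \<in> F" "weighted_norm p w f < \<infinity>"
      "ennreal (N k) * weighted_norm p w g < weighted_norm p w f"
    proof -
      have "\<not> (\<forall>(f, g) \<in> F. weighted_norm p w f < \<infinity> \<longrightarrow>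
          weighted_norm p w f \<le> ennreal (N k) * weighted_norm p w g)"
      proof
        assume "\<forall>(f, g) \<in> F. weighted_norm p w f < \<infinity> \<longrightarrow>
          weighted_norm p w f \<le> ennreal (N k) * weighted_norm p w g"
        with N[of k] have "family_ineq F (weighted_norm p w)"
          unfolding family_ineq_def by (intro exI[of _ "N k"] conjI)
        with not_ineq show False ..
      qed
      then obtain z where "z \<in> F" "\<not> (case z of (f, g) \<Rightarrow> weighted_norm p w f < \<infinity> \<longrightarrow>
          weighted_norm p w f \<le> ennreal (N k) * weighted_norm p w g)"
        unfolding Ball_def not_all not_imp by (elim exE conjE) (rule that)
      then show thesis using that by (cases z) (auto simp: not_le)
    qed
    with F have meas: "f \<in> borel_measurable lebesgue" "g \<in> borel_measurable lebesgue" by auto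
    obtain a h where "0 < a" "h \<in> borel_measurable lebesgue"
      "var_ball p (\<lambda>x. ennreal a * f x * w x)" "var_ball p (\<lambda>x. ennreal (N k * a) * g x * w x)"
      "var_ball (conj_exponent p) (\<lambda>x. h x * inverse (w x))"
      "ennreal (1/8) \<le> (\<integral>\<^sup>+x. ennreal a * f x * h x \<partial>lebesgue)"
      by (rule normalized_counterexample[OF p w meas N fg(2,3)])
    with fg(1) meas have "Q k f g h a" by (simp add: Q_def)
    then show ?thesis by blast
  qed
  then obtain f g h a where "\<And>k. Q k (f k) (g k) (h k) (a k)" by metis
  then show thesis by (intro that[of f g a h]) (auto simp: Q_def)
qed

text \<open>
  Both integrals are homogeneous of degree \<open>P\<close>, so the weighted inequality for \<open>(f, g)\<close> becomes an
  inequality for \<open>(\<alpha> f, N \<alpha> g)\<close> that gains \<open>N\<^sup>-\<^sup>P\<close>.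
\<close>

lemma scaled_weighted_ineq:
  assumes [measurable]: "f \<in> borel_measurable lebesgue" "g \<in> borel_measurable lebesgue" "v \<in> borel_measurable lebesgue"
    and P: "0 < P" and \<alpha>: "0 < \<alpha>" and N: "0 < N" and C: "0 \<le> C"
    and ineq: "(\<integral>\<^sup>+x. enn_powr (f x) P * v x \<partial>lebesgue) < \<infinity> \<Longrightarrow>
        (\<integral>\<^sup>+x. enn_powr (f x) P * v x \<partial>lebesgue) \<le> ennreal C * (\<integral>\<^sup>+x. enn_powr (g x) P * v x \<partial>lebesgue)"
    and fin: "(\<integral>\<^sup>+x. enn_powr (ennreal \<alpha> * f x) P * v x \<partial>lebesgue) < \<infinity>"
  shows "(\<integral>\<^sup>+x. enn_powr (ennreal \<alpha> * f x) P * v x \<partial>lebesgue)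
    \<le> ennreal (C * N powr - P) * (\<integral>\<^sup>+x. enn_powr (ennreal (N * \<alpha>) * g x) P * v x \<partial>lebesgue)"
proof -
  have scale: "(\<integral>\<^sup>+x. enn_powr (ennreal c * h x) P * v x \<partial>lebesgue)
      = ennreal (c powr P) * (\<integral>\<^sup>+x. enn_powr (h x) P * v x \<partial>lebesgue)"
    if [measurable]: "h \<in> borel_measurable lebesgue" and c: "0 < c" for h :: "'a \<Rightarrow> ennreal" and c
    using P c by (simp add: enn_powr_mult enn_powr_ennreal mult.assoc nn_integral_cmult)
  have "(\<integral>\<^sup>+x. enn_powr (f x) P * v x \<partial>lebesgue) < \<infinity>"
    using fin \<alpha> by (auto simp: scale ennreal_mult_less_top)
  from ineq[OF this]
  have "ennreal (\<alpha> powr P) * (\<integral>\<^sup>+x. enn_powr (f x) P * v x \<partial>lebesgue)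
      \<le> ennreal (\<alpha> powr P) * (ennreal C * (\<integral>\<^sup>+x. enn_powr (g x) P * v x \<partial>lebesgue))"
    by (rule mult_left_mono) simp
  also have "\<dots> = ennreal (C * N powr - P) * (ennreal ((N * \<alpha>) powr P) * (\<integral>\<^sup>+x. enn_powr (g x) P * v x \<partial>lebesgue))"
  proof -
    have "N powr - P * N powr P = 1" using N by (simp flip: powr_add)
    then have "(C * N powr - P) * (N * \<alpha>) powr P = \<alpha> powr P * C"
      using N \<alpha> by (simp add: powr_mult)
    then have "ennreal (C * N powr - P) * ennreal ((N * \<alpha>) powr P) = ennreal (\<alpha> powr P) * ennreal C"
      using C by (simp flip: ennreal_mult)
    then show ?thesis by (simp add: mult.assoc[symmetric])
  qed
  finally show ?thesis using \<alpha> N by (simp add: scale)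
qed

text \<open>
  For \<open>t > m\<close> the last summand suffices, since \<open>t = t\<^sup>1\<^sup>-\<^sup>P t\<^sup>P\<close> and the exponent \<open>1 - P\<close> is negative.
\<close>

lemma le_add_powr_mult:
  assumes P: "1 < P" and m: "0 < m"
  shows "t \<le> ennreal m + ennreal (m powr (1 - P)) * enn_powr t P"
proof (cases "t \<le> ennreal m")
  case False
  show ?thesis
  proof (cases t)
    case (real s)
    with False have s: "m < s" using m by (simp add: not_le ennreal_less_iff)
    have "s = s powr (1 - P) * s powr P" using s m by (simp flip: powr_add)
    also have "\<dots> \<le> m powr (1 - P) * s powr P"
      using P s m by (intro mult_right_mono powr_mono2') auto
    finally have "t \<le> ennreal (m powr (1 - P)) * enn_powr t P"
      using real s m by (simp add: enn_powr_ennreal ennreal_leI flip: ennreal_mult)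
    then show ?thesis by (simp add: add_increasing)
  next
    case top
    then show ?thesis using P m by (simp add: enn_powr_def ennreal_mult_top)
  qed
qed (simp add: add_increasing2)

text \<open>
  A substitute for \<open>\<integral> f v\<^sub>2 \<le> (\<integral> f\<^sup>P v\<^sub>1\<^sup>1\<^sup>-\<^sup>P v\<^sub>2)\<^sup>1\<^sup>/\<^sup>P (\<integral> v\<^sub>1 v\<^sub>2)\<^sup>1\<^sup>-\<^sup>1\<^sup>/\<^sup>P\<close>: the free parameter \<open>l\<close> makes a
  pointwise estimate sufficient, namely the comparison of \<open>f\<close> with \<open>l v\<^sub>1\<close>.
\<close>

lemma nn_integral_mult_le_factored:
  assumes [measurable]: "f \<in> borel_measurable lebesgue" "v\<^sub>1 \<in> borel_measurable lebesgue" "v\<^sub>2 \<in> borel_measurable lebesgue"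
    and v\<^sub>1: "AE x in lebesgue. 0 < v\<^sub>1 x \<and> v\<^sub>1 x < \<infinity>" and P: "1 < P" and l: "0 < l"
  shows "(\<integral>\<^sup>+x. f x * v\<^sub>2 x \<partial>lebesgue) \<le> ennreal l * (\<integral>\<^sup>+x. v\<^sub>1 x * v\<^sub>2 x \<partial>lebesgue)
    + ennreal (l powr (1 - P)) * (\<integral>\<^sup>+x. enn_powr (f x) P * (enn_powr (v\<^sub>1 x) (1 - P) * v\<^sub>2 x) \<partial>lebesgue)"
proof -
  have "(\<integral>\<^sup>+x. f x * v\<^sub>2 x \<partial>lebesgue) \<le> (\<integral>\<^sup>+x. ennreal l * (v\<^sub>1 x * v\<^sub>2 x)
      + ennreal (l powr (1 - P)) * (enn_powr (f x) P * (enn_powr (v\<^sub>1 x) (1 - P) * v\<^sub>2 x)) \<partial>lebesgue)"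
  proof (rule nn_integral_mono_AE)
    show "AE x in lebesgue. f x * v\<^sub>2 x \<le> ennreal l * (v\<^sub>1 x * v\<^sub>2 x)
      + ennreal (l powr (1 - P)) * (enn_powr (f x) P * (enn_powr (v\<^sub>1 x) (1 - P) * v\<^sub>2 x))"
      using v\<^sub>1
    proof eventually_elim
      case (elim x)
      then obtain r where r: "v\<^sub>1 x = ennreal r" "0 < r" by (cases "v\<^sub>1 x") auto
      have "f x * v\<^sub>2 x \<le> (ennreal (l * r) + ennreal ((l * r) powr (1 - P)) * enn_powr (f x) P) * v\<^sub>2 x"
        using l r P by (intro mult_right_mono le_add_powr_mult) auto
      also have "\<dots> = ennreal l * (v\<^sub>1 x * v\<^sub>2 x)
          + ennreal (l powr (1 - P)) * (enn_powr (f x) P * (enn_powr (v\<^sub>1 x) (1 - P) * v\<^sub>2 x))"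
        using l r by (simp add: enn_powr_ennreal powr_mult ennreal_mult distrib_left distrib_right ac_simps)
      finally show ?case .
    qed
  qed
  also have "\<dots> = ennreal l * (\<integral>\<^sup>+x. v\<^sub>1 x * v\<^sub>2 x \<partial>lebesgue)
    + ennreal (l powr (1 - P)) * (\<integral>\<^sup>+x. enn_powr (f x) P * (enn_powr (v\<^sub>1 x) (1 - P) * v\<^sub>2 x) \<partial>lebesgue)"
    by (subst nn_integral_add; (measurable)?) (simp add: nn_integral_cmult)
  finally show ?thesis .
qed

text \<open>
  This bound makes the left-hand side of the weighted inequality finite, which is a condition for
  applying it, and it bounds the right-hand side as well.
\<close>

lemma nn_integral_powr_le_of_le:
  assumes [measurable]: "v\<^sub>1 \<in> borel_measurable lebesgue" "v\<^sub>2 \<in> borel_measurable lebesgue"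
    and v\<^sub>1: "AE x in lebesgue. 0 < v\<^sub>1 x \<and> v\<^sub>1 x < \<infinity>" and P: "1 < P" and K: "0 < K"
    and le: "\<And>x. f x \<le> ennreal K * v\<^sub>1 x"
  shows "(\<integral>\<^sup>+x. enn_powr (f x) P * (enn_powr (v\<^sub>1 x) (1 - P) * v\<^sub>2 x) \<partial>lebesgue)
    \<le> ennreal (K powr P) * (\<integral>\<^sup>+x. v\<^sub>1 x * v\<^sub>2 x \<partial>lebesgue)"
proof -
  have "(\<integral>\<^sup>+x. enn_powr (f x) P * (enn_powr (v\<^sub>1 x) (1 - P) * v\<^sub>2 x) \<partial>lebesgue)
      \<le> (\<integral>\<^sup>+x. ennreal (K powr P) * (v\<^sub>1 x * v\<^sub>2 x) \<partial>lebesgue)"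
  proof (rule nn_integral_mono_AE)
    show "AE x in lebesgue. enn_powr (f x) P * (enn_powr (v\<^sub>1 x) (1 - P) * v\<^sub>2 x) \<le> ennreal (K powr P) * (v\<^sub>1 x * v\<^sub>2 x)"
      using v\<^sub>1
    proof eventually_elim
      case (elim x)
      then obtain r where r: "v\<^sub>1 x = ennreal r" "0 < r" by (cases "v\<^sub>1 x") auto
      have "enn_powr (f x) P \<le> ennreal ((K * r) powr P)"
        using enn_powr_mono[OF _ le[of x], of P] P K r
        by (simp add: enn_powr_ennreal flip: ennreal_mult)
      then have "enn_powr (f x) P * (enn_powr (v\<^sub>1 x) (1 - P) * v\<^sub>2 x)
          \<le> ennreal ((K * r) powr P) * (ennreal (r powr (1 - P)) * v\<^sub>2 x)"
        using r by (intro mult_mono) (auto simp: enn_powr_ennreal)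
      also have "\<dots> = ennreal ((K * r) powr P * r powr (1 - P)) * v\<^sub>2 x"
        by (simp add: ennreal_mult mult.assoc)
      also have "(K * r) powr P * r powr (1 - P) = K powr P * r"
        using K r by (simp add: powr_mult mult.assoc flip: powr_add)
      finally show ?case using r by (simp add: ennreal_mult mult.assoc)
    qed
  qed
  also have "\<dots> = ennreal (K powr P) * (\<integral>\<^sup>+x. v\<^sub>1 x * v\<^sub>2 x \<partial>lebesgue)"
    by (rule nn_integral_cmult) measurable
  finally show ?thesis .
qed

lemma not_bounded_below_half_powers:
  fixes A c :: real
  assumes "0 < c" "\<And>k. c \<le> A * (1/2)^(k + 1)"
  shows False
proof -
  have "(\<lambda>k. A * (1/2)^(k + 1)) \<longlonglongrightarrow> A * 0"
    by (intro tendsto_mult tendsto_const LIMSEQ_ignore_initial_segment LIMSEQ_power_zero) simp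
  then have "c \<le> A * 0" by (rule LIMSEQ_le_const) (use assms in auto)
  with assms show False by simp
qed

section \<open>Extrapolation\<close>

lemma nn_integral_mult_majorant_le:
  assumes [measurable]: "f \<in> borel_measurable lebesgue" "R \<in> borel_measurable lebesgue"
    and "\<And>x. h x \<le> c * R x"
  shows "(\<integral>\<^sup>+x. f x * h x \<partial>lebesgue) \<le> c * (\<integral>\<^sup>+x. f x * R x \<partial>lebesgue)"
proof -
  have "(\<integral>\<^sup>+x. f x * h x \<partial>lebesgue) \<le> (\<integral>\<^sup>+x. c * (f x * R x) \<partial>lebesgue)"
  proof (rule nn_integral_mono)
    fix x show "f x * h x \<le> c * (f x * R x)"
      using mult_left_mono[OF assms(3)[of x], of "f x"] by (simp add: mult.left_commute)
  qed
  also have "\<dots> = c * (\<integral>\<^sup>+x. f x * R x \<partial>lebesgue)"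
    by (rule nn_integral_cmult) measurable
  finally show ?thesis .
qed

lemma ennreal_mult3:
  "0 \<le> a \<Longrightarrow> 0 \<le> b \<Longrightarrow> 0 \<le> c \<Longrightarrow> ennreal a * (ennreal b * ennreal c) = ennreal (a * b * c)"
  by (simp add: ennreal_mult mult.assoc)

text \<open>
  With \<open>N\<^sub>k = 8\<^sup>k\<^sup>+\<^sup>1\<close>, a single weight \<open>R\<close> in \<open>A\<^sub>1\<close> majorises all the dual functions \<open>h\<^sub>k\<close> up to \<open>4\<^sup>k\<^sup>+\<^sup>1\<close>,
  so \<open>1/8 \<le> 4\<^sup>k\<^sup>+\<^sup>1 \<integral> \<alpha>\<^sub>k f\<^sub>k R\<close>. The hypothesis for \<open>R\<close> gains \<open>1/N\<^sub>k\<close>, which outweighs this loss as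
  \<open>k\<close> grows.
\<close>

theorem extrapolation_from_A_1:
  fixes F :: "(('a::euclidean_space \<Rightarrow> ennreal) \<times> ('a \<Rightarrow> ennreal)) set"
  assumes F: "\<forall>(f, g) \<in> F. f \<in> borel_measurable lebesgue \<and> g \<in> borel_measurable lebesgue"
    and hyp: "\<forall>w\<^sub>0 \<in> A_1. family_ineq F (\<lambda>h. \<integral>\<^sup>+x. h x * w\<^sub>0 x \<partial>lebesgue)"
    and p: "p \<in> var_exponents" and w: "w \<in> pos_finite_weights"
    and M: "maximal_bounded (conj_exponent p) (\<lambda>x. inverse (w x))"
  shows "family_ineq F (weighted_norm p w)"
proof (rule ccontr)
  assume not_ineq: "\<not> family_ineq F (weighted_norm p w)"
  define N :: "nat \<Rightarrow> real" where "N k = 8^(k + 1)" for k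
  have N: "0 < N k" for k by (simp add: N_def)
  obtain f g h \<alpha> where fg: "\<And>k. (f k, g k) \<in> F" and \<alpha>: "\<And>k. 0 < \<alpha> k"
    and meas [measurable]: "\<And>k. f k \<in> borel_measurable lebesgue" "\<And>k. g k \<in> borel_measurable lebesgue"
      "\<And>k. h k \<in> borel_measurable lebesgue"
    and ball_f: "\<And>k. var_ball p (\<lambda>x. ennreal (\<alpha> k) * f k x * w x)"
    and ball_g: "\<And>k. var_ball p (\<lambda>x. ennreal (N k * \<alpha> k) * g k x * w x)"
    and ball_h: "\<And>k. var_ball (conj_exponent p) (\<lambda>x. h k x * inverse (w x))"
    and large: "\<And>k. ennreal (1/8) \<le> (\<integral>\<^sup>+x. ennreal (\<alpha> k) * f k x * h k x \<partial>lebesgue)"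
    by (rule counterexample_sequence[where N = N, OF F p w not_ineq N]) blast
  obtain R C where C: "0 < C" and R [measurable]: "R \<in> borel_measurable lebesgue"
    and h_le: "\<And>k x. h k x \<le> ennreal (4^(k + 1)) * R x"
    and max: "\<And>x. HL_max R x \<le> ennreal C * R x"
    and ball_R: "var_ball (conj_exponent p) (\<lambda>x. ennreal (1/4) * (R x * inverse (w x)))"
    by (rule Rubio_de_Francia_sequence[where h = h, OF conj_exponent_in_var_exponents[OF p]
          inverse_pos_finite_weights[OF w] M meas(3) ball_h]) blast
  have "R \<in> A_1" using R max C by (rule A_1_of_HL_max_le)
  with hyp obtain C\<^sub>0 where C\<^sub>0: "0 < C\<^sub>0"
    and ineq: "\<And>f g. (f, g) \<in> F \<Longrightarrow> (\<integral>\<^sup>+x. f x * R x \<partial>lebesgue) < \<infinity> \<Longrightarrow>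
      (\<integral>\<^sup>+x. f x * R x \<partial>lebesgue) \<le> ennreal C\<^sub>0 * (\<integral>\<^sup>+x. g x * R x \<partial>lebesgue)"
    unfolding family_ineq_def by fast
  have "1/8 \<le> (8 * C\<^sub>0) * (1/2)^(k + 1)" for k
  proof -
    have pair: "(\<integral>\<^sup>+x. ennreal (\<alpha> k) * f k x * R x \<partial>lebesgue) \<le> 8"
      "(\<integral>\<^sup>+x. ennreal (N k * \<alpha> k) * g k x * R x \<partial>lebesgue) \<le> 8"
      by (intro nn_integral_mult_le_weighted[OF p w] ball_f ball_g ball_R; measurable)+
    have "(\<integral>\<^sup>+x. enn_powr (ennreal (\<alpha> k) * f k x) 1 * R x \<partial>lebesgue)
        \<le> ennreal (C\<^sub>0 * N k powr - 1) * (\<integral>\<^sup>+x. enn_powr (ennreal (N k * \<alpha> k) * g k x) 1 * R x \<partial>lebesgue)"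
    proof (rule scaled_weighted_ineq)
      show "(\<integral>\<^sup>+x. enn_powr (ennreal (\<alpha> k) * f k x) 1 * R x \<partial>lebesgue) < \<infinity>"
        using le_less_trans[OF pair(1), of \<infinity>] by simp
      show "(\<integral>\<^sup>+x. enn_powr (f k x) 1 * R x \<partial>lebesgue)
          \<le> ennreal C\<^sub>0 * (\<integral>\<^sup>+x. enn_powr (g k x) 1 * R x \<partial>lebesgue)"
        if "(\<integral>\<^sup>+x. enn_powr (f k x) 1 * R x \<partial>lebesgue) < \<infinity>"
        using ineq[OF fg] that by simp
    qed (use C\<^sub>0 \<alpha> N in \<open>auto simp: less_imp_le\<close>)
    also have "\<dots> \<le> ennreal (C\<^sub>0 * N k powr - 1) * ennreal 8"
      using pair(2) by (intro mult_left_mono) auto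
    finally have "ennreal (4^(k + 1)) * (\<integral>\<^sup>+x. ennreal (\<alpha> k) * f k x * R x \<partial>lebesgue)
        \<le> ennreal (4^(k + 1)) * (ennreal (C\<^sub>0 * N k powr - 1) * ennreal 8)"
      by (intro mult_left_mono) auto
    also have "\<dots> = ennreal (4^(k + 1) * (C\<^sub>0 * N k powr - 1) * 8)"
      using C\<^sub>0 by (subst ennreal_mult3) auto
    also have "4^(k + 1) * (C\<^sub>0 * N k powr - 1) * 8 = (8 * C\<^sub>0) * (1/2)^(k + 1)"
    proof -
      have "(8::real)^(k + 1) = 4^(k + 1) * 2^(k + 1)" by (simp flip: power_mult_distrib)
      then show ?thesis by (simp add: N_def powr_minus_divide power_divide)
    qed
    finally have "ennreal (1/8) \<le> ennreal ((8 * C\<^sub>0) * (1/2)^(k + 1))"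
      by (rule order_trans[OF order_trans[OF large nn_integral_mult_majorant_le], rotated -1])
        (measurable, rule h_le)
    then show ?thesis using C\<^sub>0 by (simp add: ennreal_le_iff)
  qed
  then show False by (rule not_bounded_below_half_powers[rotated]) simp
qed

text \<open>
  A second majorant \<open>R\<^sub>1\<close> dominates all the functions \<open>\<alpha>\<^sub>k f\<^sub>k\<close> and \<open>N\<^sub>k \<alpha>\<^sub>k g\<^sub>k\<close>, and the weight is
  \<open>R\<^sub>1\<^sup>1\<^sup>-\<^sup>P R\<^sub>2\<close>. The losses are \<open>4\<^sup>k\<^sup>+\<^sup>1\<close> from \<open>R\<^sub>2\<close> and \<open>16\<^sup>k\<^sup>+\<^sup>1\<close> from \<open>R\<^sub>1\<close>, whose sequence interleaves
  two sequences; together they are \<open>64\<^sup>k\<^sup>+\<^sup>1\<close>, and \<open>N\<^sub>k = 128\<^sup>k\<^sup>+\<^sup>1\<close> outweighs them.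
\<close>

theorem extrapolation_from_A_p:
  fixes F :: "(('a::euclidean_space \<Rightarrow> ennreal) \<times> ('a \<Rightarrow> ennreal)) set"
  assumes F: "\<forall>(f, g) \<in> F. f \<in> borel_measurable lebesgue \<and> g \<in> borel_measurable lebesgue"
    and P: "1 < P"
    and hyp: "\<forall>w\<^sub>0 \<in> A_p P. family_ineq F (\<lambda>h. \<integral>\<^sup>+x. enn_powr (h x) P * w\<^sub>0 x \<partial>lebesgue)"
    and M_pair: "M_pair p w"
  shows "family_ineq F (weighted_norm p w)"
proof (rule ccontr)
  have p: "p \<in> var_exponents" and w: "w \<in> pos_finite_weights" and M\<^sub>1: "maximal_bounded p w"
    and M\<^sub>2: "maximal_bounded (conj_exponent p) (\<lambda>x. inverse (w x))"
    using M_pair by (auto simp: M_pair_def)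
  assume not_ineq: "\<not> family_ineq F (weighted_norm p w)"
  define N :: "nat \<Rightarrow> real" where "N k = 128^(k + 1)" for k
  have N: "0 < N k" for k by (simp add: N_def)
  obtain f g h \<alpha> where fg: "\<And>k. (f k, g k) \<in> F" and \<alpha>: "\<And>k. 0 < \<alpha> k"
    and meas [measurable]: "\<And>k. f k \<in> borel_measurable lebesgue" "\<And>k. g k \<in> borel_measurable lebesgue"
      "\<And>k. h k \<in> borel_measurable lebesgue"
    and ball_f: "\<And>k. var_ball p (\<lambda>x. ennreal (\<alpha> k) * f k x * w x)"
    and ball_g: "\<And>k. var_ball p (\<lambda>x. ennreal (N k * \<alpha> k) * g k x * w x)"
    and ball_h: "\<And>k. var_ball (conj_exponent p) (\<lambda>x. h k x * inverse (w x))"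
    and large: "\<And>k. ennreal (1/8) \<le> (\<integral>\<^sup>+x. ennreal (\<alpha> k) * f k x * h k x \<partial>lebesgue)"
    by (rule counterexample_sequence[where N = N, OF F p w not_ineq N]) blast
  define s where "s k x = (if even k then ennreal (\<alpha> (k div 2)) * f (k div 2) x
      else ennreal (N (k div 2) * \<alpha> (k div 2)) * g (k div 2) x)" for k x
  have s_meas: "s k \<in> borel_measurable lebesgue" for k
    by (cases "even k") (simp_all add: s_def[abs_def])
  have s_ball: "var_ball p (\<lambda>x. s k x * w x)" for k
    using ball_f[of "k div 2"] ball_g[of "k div 2"] by (cases "even k") (simp_all add: s_def)
  obtain R\<^sub>1 C\<^sub>1 where C\<^sub>1: "0 < C\<^sub>1" and R\<^sub>1 [measurable]: "R\<^sub>1 \<in> borel_measurable lebesgue"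
    and s_le: "\<And>k x. s k x \<le> ennreal (4^(k + 1)) * R\<^sub>1 x"
    and max\<^sub>1: "\<And>x. HL_max R\<^sub>1 x \<le> ennreal C\<^sub>1 * R\<^sub>1 x"
    and ball_R\<^sub>1: "var_ball p (\<lambda>x. ennreal (1/4) * (R\<^sub>1 x * w x))"
    by (rule Rubio_de_Francia_sequence[where h = s, OF p w M\<^sub>1 s_meas s_ball]) blast
  obtain R\<^sub>2 C\<^sub>2 where C\<^sub>2: "0 < C\<^sub>2" and R\<^sub>2 [measurable]: "R\<^sub>2 \<in> borel_measurable lebesgue"
    and h_le: "\<And>k x. h k x \<le> ennreal (4^(k + 1)) * R\<^sub>2 x"
    and max\<^sub>2: "\<And>x. HL_max R\<^sub>2 x \<le> ennreal C\<^sub>2 * R\<^sub>2 x"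
    and ball_R\<^sub>2: "var_ball (conj_exponent p) (\<lambda>x. ennreal (1/4) * (R\<^sub>2 x * inverse (w x)))"
    by (rule Rubio_de_Francia_sequence[where h = h, OF conj_exponent_in_var_exponents[OF p]
          inverse_pos_finite_weights[OF w] M\<^sub>2 meas(3) ball_h]) blast
  have [measurable]: "w \<in> borel_measurable lebesgue"
    using w by (auto simp: pos_finite_weights_def weights_def)

  \<comment> \<open>The lower bound on the pairing keeps both majorants from vanishing, and hence makes them positive.\<close>
  have nonzero: "\<not> (AE x in lebesgue. f 0 x * h 0 x = 0)"
  proof
    assume "AE x in lebesgue. f 0 x * h 0 x = 0"
    then have "(\<integral>\<^sup>+x. ennreal (\<alpha> 0) * f 0 x * h 0 x \<partial>lebesgue) = 0"
      by (subst nn_integral_0_iff_AE) (auto simp: mult.assoc elim!: eventually_mono)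
    with large[of 0] show False by simp
  qed
  have pos\<^sub>1: "0 < R\<^sub>1 x" for x
  proof -
    have "\<not> (AE x in lebesgue. R\<^sub>1 x = 0)"
    proof
      assume "AE x in lebesgue. R\<^sub>1 x = 0"
      then have "AE x in lebesgue. f 0 x * h 0 x = 0"
      proof eventually_elim
        case (elim x)
        then show ?case using s_le[of 0 x] \<alpha>[of 0] by (simp add: s_def)
      qed
      with nonzero show False ..
    qed
    from HL_max_pos[OF R\<^sub>1 this, of x] max\<^sub>1[of x] have "0 < ennreal C\<^sub>1 * R\<^sub>1 x" by (rule less_le_trans)
    then show ?thesis by (simp add: ennreal_zero_less_mult_iff)
  qed
  have pos\<^sub>2: "0 < R\<^sub>2 x" for x
  proof -
    have "\<not> (AE x in lebesgue. R\<^sub>2 x = 0)"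
    proof
      assume "AE x in lebesgue. R\<^sub>2 x = 0"
      then have "AE x in lebesgue. f 0 x * h 0 x = 0"
      proof eventually_elim
        case (elim x)
        then show ?case using h_le[of 0 x] by simp
      qed
      with nonzero show False ..
    qed
    from HL_max_pos[OF R\<^sub>2 this, of x] max\<^sub>2[of x] have "0 < ennreal C\<^sub>2 * R\<^sub>2 x" by (rule less_le_trans)
    then show ?thesis by (simp add: ennreal_zero_less_mult_iff)
  qed
  have finite: "AE x in lebesgue. 0 < w x \<and> w x < \<infinity>"
    using w by (auto simp: pos_finite_weights_def)
  have AE\<^sub>1: "AE x in lebesgue. 0 < R\<^sub>1 x \<and> R\<^sub>1 x < \<infinity>"
  proof -
    have "AE x in lebesgue. ennreal (1/4) * (R\<^sub>1 x * w x) < \<infinity>"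
      by (rule var_ball_finite_AE[OF p _ ball_R\<^sub>1]) measurable
    then show ?thesis using finite
      by eventually_elim (use pos\<^sub>1 in \<open>auto simp: ennreal_mult_less_top\<close>)
  qed
  have AE\<^sub>2: "AE x in lebesgue. 0 < R\<^sub>2 x \<and> R\<^sub>2 x < \<infinity>"
  proof -
    have "AE x in lebesgue. ennreal (1/4) * (R\<^sub>2 x * inverse (w x)) < \<infinity>"
      by (rule var_ball_finite_AE[OF conj_exponent_in_var_exponents[OF p] _ ball_R\<^sub>2]) measurable
    then show ?thesis using finite
      by eventually_elim (use pos\<^sub>2 in \<open>auto simp: ennreal_mult_less_top\<close>)
  qed

  define w\<^sub>0 where "w\<^sub>0 x = enn_powr (R\<^sub>1 x) (1 - P) * R\<^sub>2 x" for x
  have w\<^sub>0_meas [measurable]: "w\<^sub>0 \<in> borel_measurable lebesgue" unfolding w\<^sub>0_def by measurable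
  have "w\<^sub>0 \<in> A_p P"
    unfolding w\<^sub>0_def using R\<^sub>1 R\<^sub>2 AE\<^sub>1 AE\<^sub>2 max\<^sub>1 C\<^sub>1 max\<^sub>2 C\<^sub>2 P by (rule A_p_of_HL_max_le)
  with hyp obtain C\<^sub>0 where C\<^sub>0: "0 < C\<^sub>0"
    and ineq: "\<And>f g. (f, g) \<in> F \<Longrightarrow> (\<integral>\<^sup>+x. enn_powr (f x) P * w\<^sub>0 x \<partial>lebesgue) < \<infinity> \<Longrightarrow>
      (\<integral>\<^sup>+x. enn_powr (f x) P * w\<^sub>0 x \<partial>lebesgue) \<le> ennreal C\<^sub>0 * (\<integral>\<^sup>+x. enn_powr (g x) P * w\<^sub>0 x \<partial>lebesgue)"
    unfolding family_ineq_def by fast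

  define D where "D = (\<integral>\<^sup>+x. R\<^sub>1 x * R\<^sub>2 x \<partial>lebesgue)"
  have D: "D \<le> 32"
  proof -
    have "ennreal (1/4) * D = (\<integral>\<^sup>+x. (ennreal (1/4) * R\<^sub>1 x) * R\<^sub>2 x \<partial>lebesgue)"
      unfolding D_def mult.assoc by (rule nn_integral_cmult[symmetric]) measurable
    also have "\<dots> \<le> 8"
      using ball_R\<^sub>1 by (intro nn_integral_mult_le_weighted[OF p w _ _ _ ball_R\<^sub>2])
        (simp_all add: mult.assoc)
    finally have "ennreal 4 * (ennreal (1/4) * D) \<le> ennreal 4 * 8"
      by (intro mult_left_mono) auto
    moreover have "ennreal 4 * (ennreal (1/4) * D) = D"
      by (subst mult.assoc[symmetric], subst ennreal_mult[symmetric]) simp_all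
    ultimately show ?thesis by simp
  qed
  have "1/8 \<le> (32 * (1 + C\<^sub>0)) * (1/2)^(k + 1)" for k
  proof -
    define K :: real where "K = 16^(k + 1)"
    have K: "0 < K" by (simp add: K_def)
    have sq: "(4::real)^(2 * k + 2) = K" 
      unfolding K_def by (simp add: power_mult power_add)
    have f_le: "ennreal (\<alpha> k) * f k x \<le> ennreal K * R\<^sub>1 x" for x
    proof -
      have "ennreal (\<alpha> k) * f k x \<le> ennreal (4^(2 * k + 1)) * R\<^sub>1 x"
        using s_le[of "2 * k" x] by (simp add: s_def)
      also have "\<dots> \<le> ennreal K * R\<^sub>1 x"
        unfolding sq[symmetric] by (intro mult_right_mono ennreal_leI power_increasing) auto
      finally show ?thesis .
    qed
    have g_le: "ennreal (N k * \<alpha> k) * g k x \<le> ennreal K * R\<^sub>1 x" for x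
      using s_le[of "2 * k + 1" x] sq by (simp add: s_def)
    let ?J = "\<integral>\<^sup>+x. enn_powr (ennreal (\<alpha> k) * f k x) P * w\<^sub>0 x \<partial>lebesgue"
    have "?J \<le> ennreal (K powr P) * D"
      unfolding w\<^sub>0_def D_def by (rule nn_integral_powr_le_of_le[OF R\<^sub>1 R\<^sub>2 AE\<^sub>1 P K f_le])
    also have "\<dots> < \<infinity>"
      using le_less_trans[OF D, of \<infinity>] by (simp add: ennreal_mult_less_top)
    finally have fin: "?J < \<infinity>" .
    have "?J \<le> ennreal (C\<^sub>0 * N k powr - P)
        * (\<integral>\<^sup>+x. enn_powr (ennreal (N k * \<alpha> k) * g k x) P * w\<^sub>0 x \<partial>lebesgue)"
      using P C\<^sub>0 \<alpha> N fin ineq[OF fg] by (intro scaled_weighted_ineq) (auto simp: less_imp_le)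
    also have "\<dots> \<le> ennreal (C\<^sub>0 * N k powr - P) * (ennreal (K powr P) * D)"
      unfolding w\<^sub>0_def D_def
      by (intro mult_left_mono nn_integral_powr_le_of_le[OF R\<^sub>1 R\<^sub>2 AE\<^sub>1 P K g_le]) simp
    finally have J: "?J \<le> ennreal (C\<^sub>0 * N k powr - P) * (ennreal (K powr P) * D)" .

    \<comment> \<open>This choice gives both terms of the factored estimate the size of \<open>K / N\<^sub>k\<close>.\<close>
    define l where "l = K / N k"
    have l: "0 < l" using K N by (simp add: l_def)
    have "(\<integral>\<^sup>+x. ennreal (\<alpha> k) * f k x * R\<^sub>2 x \<partial>lebesgue)
        \<le> ennreal l * D + ennreal (l powr (1 - P)) * ?J"
      unfolding w\<^sub>0_def D_def by (rule nn_integral_mult_le_factored[OF _ R\<^sub>1 R\<^sub>2 AE\<^sub>1 P l]) measurable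
    also have "\<dots> \<le> ennreal l * D
        + ennreal (l powr (1 - P)) * (ennreal (C\<^sub>0 * N k powr - P) * (ennreal (K powr P) * D))"
      by (intro add_mono mult_left_mono J) auto
    also have "\<dots> = (ennreal l + ennreal (l powr (1 - P) * (C\<^sub>0 * N k powr - P * K powr P))) * D"
      using C\<^sub>0 by (simp add: ennreal_mult distrib_right mult.assoc)
    also have "l powr (1 - P) * (C\<^sub>0 * N k powr - P * K powr P) = C\<^sub>0 * l"
    proof -
      have "N k powr - P * K powr P = l powr P"
        using K N[of k] by (simp add: l_def powr_divide powr_minus_divide)
      then have "l powr (1 - P) * (C\<^sub>0 * N k powr - P * K powr P) = C\<^sub>0 * (l powr (1 - P) * l powr P)"
        by (simp add: mult.assoc mult.left_commute)
      then show ?thesis using l by (simp flip: powr_add)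
    qed
    also have "ennreal l + ennreal (C\<^sub>0 * l) = ennreal ((1 + C\<^sub>0) * l)"
      using l C\<^sub>0 by (simp add: distrib_right flip: ennreal_plus)
    also have "ennreal ((1 + C\<^sub>0) * l) * D \<le> ennreal ((1 + C\<^sub>0) * l) * ennreal 32"
      using D by (intro mult_left_mono) auto
    finally have "ennreal (4^(k + 1)) * (\<integral>\<^sup>+x. ennreal (\<alpha> k) * f k x * R\<^sub>2 x \<partial>lebesgue)
        \<le> ennreal (4^(k + 1)) * (ennreal ((1 + C\<^sub>0) * l) * ennreal 32)"
      by (intro mult_left_mono) auto
    also have "\<dots> = ennreal (4^(k + 1) * ((1 + C\<^sub>0) * l) * 32)"
      using C\<^sub>0 l by (subst ennreal_mult3) auto
    also have "4^(k + 1) * ((1 + C\<^sub>0) * l) * 32 = (32 * (1 + C\<^sub>0)) * (1/2)^(k + 1)"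
    proof -
      have "(128::real)^(k + 1) = (4^(k + 1) * 16^(k + 1)) * 2^(k + 1)"
        by (simp flip: power_mult_distrib)
      then have "4^(k + 1) * l = (1/2)^(k + 1)"
        by (simp add: l_def K_def N_def power_divide)
      then have "(1 + C\<^sub>0) * (4^(k + 1) * l) * 32 = (1 + C\<^sub>0) * (1/2)^(k + 1) * 32"
        by (simp only:)
      then show ?thesis by (simp only: ac_simps)
    qed
    finally have "ennreal (1/8) \<le> ennreal ((32 * (1 + C\<^sub>0)) * (1/2)^(k + 1))"
      by (rule order_trans[OF order_trans[OF large nn_integral_mult_majorant_le], rotated -1])
        (measurable, rule h_le)
    then show ?thesis using C\<^sub>0 by (simp add: ennreal_le_iff)
  qed
  then show False by (rule not_bounded_below_half_powers[rotated]) simp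
qed

theorem theorem2p6:
  fixes F :: "(('a::euclidean_space \<Rightarrow> ennreal) \<times> ('a \<Rightarrow> ennreal)) set"
  assumes "\<forall>(f, g) \<in> F. f \<in> borel_measurable lebesgue \<and> g \<in> borel_measurable lebesgue"
  shows
    "(\<forall>p\<^sub>0::real. 1 < p\<^sub>0 \<longrightarrow>
        (\<forall>w\<^sub>0 \<in> A_p p\<^sub>0. family_ineq F (\<lambda>h. \<integral>\<^sup>+x. enn_powr (h x) p\<^sub>0 * w\<^sub>0 x \<partial>lebesgue)) \<longrightarrow>
        (\<forall>p w. M_pair p w \<longrightarrow> family_ineq F (weighted_norm p w)))
     \<and>
     ((\<forall>w\<^sub>0 \<in> A_1. family_ineq F (\<lambda>h. \<integral>\<^sup>+x. h x * w\<^sub>0 x \<partial>lebesgue)) \<longrightarrow>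
        (\<forall>p \<in> var_exponents. \<forall>w \<in> pos_finite_weights.
           maximal_bounded (conj_exponent p) (\<lambda>x. inverse (w x)) \<longrightarrow>
           family_ineq F (weighted_norm p w)))"
  using extrapolation_from_A_p[OF assms] extrapolation_from_A_1[OF assms] by simp

end
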